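(* Let $K$ and $L$ be pre-Hilbert spaces, and let all Hilbert and pre-Hilbert spaces be endowed with the minimal $L$-norm. Then $K\otimes_lL=K\otimes_{hil}L$ and $K\widehat\otimes_lL=K\widehat\otimes_{hil}L$, both equalities being up to an $L$-isometric isomorphism, well defined by taking an elementary tensor $x\otimes y$ ($x\in K$, $y\in L$) to the same $x\otimes y$, but considered in $K\otimes_{hil}L$ and $K\widehat\otimes_{hil}L$, respectively.
   Context: All linear spaces are complex. $H$ is a fixed separable infinite-dimensional Hilbert space, $\mathcal{B}$ is the algebra of bounded operators on $H$ with the operator norm. For a linear space $E$, $HE:=H\otimes E$ (algebraic tensor product), with elementary tensors written $\xi x$; it is a left $\mathcal{B}$-module via $a\cdot(\xi x):=a(\xi)x$. A (normed) $PL$-space is a linear space $E$ together with a norm on $HE$ (the $PL$-norm) such that $\|a\cdot u\|\le\|a\|\|u\|$ for all $a\in\mathcal{B}$, $u\in HE$. Its underlying normed space is $E$ with $\|x\|:=\|\xi x\|$ for any $\xi\in H$, $\|\xi\|=1$ (independent of $\xi$). A $PL$-space is complete if its underlying normed space is complete. An (orthogonal) projection $P\in\mathcal{B}$ is a support of $u\in HE$ if $P\cdot u=u$. An $L$-space is a $PL$-space $E$ such that $\|u+v\|^2\le\|u\|^2+\|v\|^2$ whenever $u,v\in HE$ have orthogonal supports; its norm on $HE$ is then called an $L$-norm. A linear operator $\varphi:E\to F$ has amplification $\varphi_\infty:HE\to HF,\ \xi x\mapsto\xi\varphi(x)$; between $PL$-spaces, $\varphi$ is an $L$-isometric isomorphism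 if $\varphi_\infty$ is an isometric isomorphism. The completion of a $PL$-space $E$ is the complete $PL$-space $\overline{E}$ (the usual completion of the underlying normed space), where the norm on $H\overline{E}$ is induced by the natural embedding of $H\overline{E}$ into the completion $\overline{HE}$ of the normed space $HE$, $\xi x\mapsto\lim\xi x_n$ for $x_n\in E$, $x_n\to x$. The minimal $L$-norm on a normed space $E$ is the norm on $HE$ equal to that of the (non-completed) injective tensor product $H\otimes_iE$; it makes $E$ an $L$-space. $K\otimes_{hil}L$ and $K\widehat\otimes_{hil}L$ are the non-completed and completed Hilbert tensor products. Fix a unitary isomorphism $\iota:H\widehat\otimes_{hil}H\to H$, and put $\xi\diamondsuit\eta:=\iota(\xi\otimes\eta)$. For $u\in HE$, $v\in HF$ the element $u\diamondsuit v\in H(E\otimes F)$ is well defined bilinearly by $\xi x\diamondsuit\eta y:=(\xi\diamondsuit\eta)(x\otimes y)$. For $PL$-spaces $E,F$, $E\otimes_{l}F$ is the $L$-space $E\otimes F$ with the norm on $H(E\otimes F)$ $$\|U\|_{l}:=\inf\Big\{\|a\|\Big(\sum_{k=1}^n\|u_k\|^2\|v_k\|^2\Big)^{1/2}\Big\},$$ the infimum being over all representations $U=a\cdot\big(\sum_{k=1}^n u_k\diamondsuit v_k\big)$ with $a\in\mathcal{B}$, $u_k\in HE$, $v_k\in HF$, where the $u_k$ have pairwise orthogonal supports. $E\widehat\otimes_{l}F$ is the completion of $E\otimes_lF$. *)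

theory Defs
  imports "HOL-Analysis.Analysis" "HOL-Library.Poly_Mapping"
begin

section \<open>Complex linear, normed and pre-Hilbert spaces\<close>

class complex_vector = ab_group_add +
  fixes scaleC :: "complex \<Rightarrow> 'a \<Rightarrow> 'a" (infixr "*\<^sub>C" 75)
  assumes scaleC_add_right: "a *\<^sub>C (x + y) = a *\<^sub>C x + a *\<^sub>C y"
    and scaleC_add_left: "(a + b) *\<^sub>C x = a *\<^sub>C x + b *\<^sub>C x"
    and scaleC_scaleC: "a *\<^sub>C b *\<^sub>C x = (a * b) *\<^sub>C x"
    and scaleC_one: "1 *\<^sub>C x = x"

global_interpretation complex_vector:
  vector_space "scaleC :: complex \<Rightarrow> 'a \<Rightarrow> 'a :: complex_vector"
  by unfold_locales (simp_all add: scaleC_add_right scaleC_add_left scaleC_scaleC scaleC_one)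

abbreviation clinear :: "('a::complex_vector \<Rightarrow> 'b::complex_vector) \<Rightarrow> bool"
  where "clinear \<equiv> Vector_Spaces.linear scaleC scaleC"

abbreviation cspan :: "'a::complex_vector set \<Rightarrow> 'a set"
  where "cspan \<equiv> module.span scaleC"

class complex_normed_vector = complex_vector + real_normed_vector +
  assumes scaleR_scaleC: "r *\<^sub>R x = complex_of_real r *\<^sub>C x"
    and norm_scaleC: "norm (a *\<^sub>C x) = cmod a * norm x"

text \<open>Pre-Hilbert spaces; the inner product is linear in the first argument.\<close>

class complex_inner = complex_normed_vector +
  fixes cinner :: "'a \<Rightarrow> 'a \<Rightarrow> complex"
  assumes cinner_add_left: "cinner (x + y) z = cinner x z + cinner y z"
    and cinner_scaleC_left: "cinner (a *\<^sub>C x) y = a * cinner x y"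
    and cinner_commute: "cinner x y = cnj (cinner y x)"
    and cinner_self: "cinner x x = complex_of_real ((norm x)\<^sup>2)"

class complex_hilbert = complex_inner + complete_space

instantiation complex :: complex_vector
begin
definition scaleC_complex :: "complex \<Rightarrow> complex \<Rightarrow> complex"
  where "scaleC_complex a x = a * x"
instance
  by standard (simp_all add: scaleC_complex_def algebra_simps)
end

definition bounded_clinear ::
    "('a::complex_normed_vector \<Rightarrow> 'b::complex_normed_vector) \<Rightarrow> bool"
  where "bounded_clinear a \<longleftrightarrow> clinear a \<and> bounded_linear a"

definition projection :: "('h::complex_inner \<Rightarrow> 'h) \<Rightarrow> bool"
  where "projection P \<longleftrightarrow>
    bounded_clinear P \<and> P \<circ> P = P \<and> (\<forall>x y. cinner (P x) y = cinner x (P y))"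

definition unitary_iso :: "('a::complex_inner \<Rightarrow> 'b::complex_inner) \<Rightarrow> bool"
  where "unitary_iso f \<longleftrightarrow> clinear f \<and> bij f \<and> (\<forall>x y. cinner (f x) (f y) = cinner x y)"


section \<open>The algebraic tensor product\<close>

instantiation poly_mapping :: (type, complex_vector) complex_vector
begin
definition scaleC_poly_mapping :: "complex \<Rightarrow> ('a \<Rightarrow>\<^sub>0 'b) \<Rightarrow> ('a \<Rightarrow>\<^sub>0 'b)"
  where "scaleC_poly_mapping a f = Poly_Mapping.map (scaleC a) f"

lemma lookup_scaleC: "Poly_Mapping.lookup (a *\<^sub>C f) k = a *\<^sub>C Poly_Mapping.lookup f k"
  for f :: "'a \<Rightarrow>\<^sub>0 'b"
  by (simp add: scaleC_poly_mapping_def Poly_Mapping.map.rep_eq when_def)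

instance
  by standard
    (rule poly_mapping_eqI, simp add: lookup_scaleC lookup_add
      scaleC_add_right scaleC_add_left scaleC_scaleC scaleC_one)+
end

text \<open>The free linear space on pairs, modulo the bilinearity relations.\<close>

abbreviation formal_tensor :: "'a \<Rightarrow> 'b \<Rightarrow> ('a \<times> 'b \<Rightarrow>\<^sub>0 complex)"
  where "formal_tensor x y \<equiv> Poly_Mapping.single (x, y) 1"

definition bilinearity_relators ::
    "('a::complex_vector \<times> 'b::complex_vector \<Rightarrow>\<^sub>0 complex) set"
  where "bilinearity_relators =
     {formal_tensor (x + x') y - formal_tensor x y - formal_tensor x' y | x x' y. True}
   \<union> {formal_tensor x (y + y') - formal_tensor x y - formal_tensor x y' | x y y'. True}
   \<union> {formal_tensor (a *\<^sub>C x) y - a *\<^sub>C formal_tensor x y | a x y. True}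
   \<union> {formal_tensor x (a *\<^sub>C y) - a *\<^sub>C formal_tensor x y | a x y. True}"

definition tensor_rel ::
    "('a::complex_vector \<times> 'b::complex_vector \<Rightarrow>\<^sub>0 complex) \<Rightarrow> ('a \<times> 'b \<Rightarrow>\<^sub>0 complex) \<Rightarrow> bool"
  where "tensor_rel f g \<longleftrightarrow> f - g \<in> cspan bilinearity_relators"

lemma tensor_rel_add:
  assumes "tensor_rel f f'" "tensor_rel g g'"
  shows "tensor_rel (f + g) (f' + g')"
  using complex_vector.span_add[OF assms[unfolded tensor_rel_def]]
  by (simp add: tensor_rel_def algebra_simps)

lemma tensor_rel_diff:
  assumes "tensor_rel f f'" "tensor_rel g g'"
  shows "tensor_rel (f - g) (f' - g')"
  using complex_vector.span_diff[OF assms[unfolded tensor_rel_def]]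
  by (simp add: tensor_rel_def algebra_simps)

lemma tensor_rel_scaleC:
  assumes "tensor_rel f f'"
  shows "tensor_rel (a *\<^sub>C f) (a *\<^sub>C f')"
  using complex_vector.span_scale[OF assms[unfolded tensor_rel_def], of a]
  by (simp add: tensor_rel_def complex_vector.scale_right_diff_distrib)

lemma tensor_rel_refl: "tensor_rel f f"
  by (simp add: tensor_rel_def complex_vector.span_zero)

quotient_type (overloaded) ('a, 'b) tensor =
  "'a::complex_vector \<times> 'b::complex_vector \<Rightarrow>\<^sub>0 complex" / tensor_rel
proof (rule equivpI)
  show "reflp tensor_rel"
    by (simp add: reflp_def tensor_rel_refl)
  show "symp tensor_rel"
    by (metis (no_types, lifting) complex_vector.span_neg minus_diff_eq sympI tensor_rel_def)
  show "transp tensor_rel"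
    using complex_vector.span_add
    by (metis (no_types, lifting) diff_add_cancel add_diff_eq tensor_rel_def transpI)
qed

instantiation tensor :: (complex_vector, complex_vector) complex_vector
begin
lift_definition zero_tensor :: "('a, 'b) tensor" is 0 .
lift_definition plus_tensor :: "('a, 'b) tensor \<Rightarrow> ('a, 'b) tensor \<Rightarrow> ('a, 'b) tensor" is "(+)"
  by (rule tensor_rel_add)
lift_definition minus_tensor :: "('a, 'b) tensor \<Rightarrow> ('a, 'b) tensor \<Rightarrow> ('a, 'b) tensor" is "(-)"
  by (rule tensor_rel_diff)
lift_definition uminus_tensor :: "('a, 'b) tensor \<Rightarrow> ('a, 'b) tensor" is uminus
  using tensor_rel_diff[OF tensor_rel_refl, of _ _ 0] by simp
lift_definition scaleC_tensor :: "complex \<Rightarrow> ('a, 'b) tensor \<Rightarrow> ('a, 'b) tensor" is scaleC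
  by (rule tensor_rel_scaleC)
instance
  by standard
    (transfer; simp add: tensor_rel_refl algebra_simps scaleC_add_right scaleC_add_left
      scaleC_scaleC scaleC_one)+
end

lift_definition tensor_of ::
    "'a::complex_vector \<Rightarrow> 'b::complex_vector \<Rightarrow> ('a, 'b) tensor" (infixr "\<otimes>" 72)
  is formal_tensor .

definition cbilinear ::
    "('a::complex_vector \<Rightarrow> 'b::complex_vector \<Rightarrow> 'c::complex_vector) \<Rightarrow> bool"
  where "cbilinear \<beta> \<longleftrightarrow> (\<forall>y. clinear (\<lambda>x. \<beta> x y)) \<and> (\<forall>x. clinear (\<beta> x))"

text \<open>
  The linear map on the tensor product induced by a bilinear map \<open>\<beta>\<close>. The description is
  meaningful for bilinear \<open>\<beta>\<close> by the universal property, proved below as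
  \<open>tensor_lift_tensor_of\<close> and \<open>clinear_tensor_lift\<close>.
\<close>

definition tensor_lift ::
    "('a::complex_vector \<Rightarrow> 'b::complex_vector \<Rightarrow> 'c::complex_vector) \<Rightarrow> ('a, 'b) tensor \<Rightarrow> 'c"
  where "tensor_lift \<beta> = (THE f. clinear f \<and> (\<forall>x y. f (x \<otimes> y) = \<beta> x y))"

lemma clinearI:
  assumes "\<And>x y. f (x + y) = f x + f y" "\<And>a x. f (a *\<^sub>C x) = a *\<^sub>C f x"
  shows "clinear f"
  by unfold_locales (simp_all add: assms)

lemma clinear_add: "clinear f \<Longrightarrow> f (x + y) = f x + f y"
  by (rule module_hom.add) (simp add: linear_iff_module_hom)

lemma clinear_scaleC: "clinear f \<Longrightarrow> f (a *\<^sub>C x) = a *\<^sub>C f x"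
  by (rule module_hom.scale) (simp add: linear_iff_module_hom)

lemma clinear_diff: "clinear f \<Longrightarrow> f (x - y) = f x - f y"
  by (rule module_hom.diff) (simp add: linear_iff_module_hom)

lemma clinear_sum: "clinear f \<Longrightarrow> f (\<Sum>i\<in>I. g i) = (\<Sum>i\<in>I. f (g i))"
  by (rule module_hom.sum) (simp add: linear_iff_module_hom)

lemma tensor_induct [case_names tensor_of add, induct type: tensor]:
  fixes t :: "('a::complex_vector, 'b::complex_vector) tensor"
  assumes elem: "\<And>x y. P (x \<otimes> y)" and add: "\<And>s t. P s \<Longrightarrow> P t \<Longrightarrow> P (s + t)"
  shows "P t"
proof -
  have scale: "(a *\<^sub>C x) \<otimes> y = a *\<^sub>C (x \<otimes> y)" for a and x :: 'a and y :: 'b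
  proof (transfer fixing: a x y)
    show "tensor_rel (formal_tensor (a *\<^sub>C x) y) (a *\<^sub>C formal_tensor x y)"
      unfolding tensor_rel_def
      by (rule complex_vector.span_base) (auto simp: bilinearity_relators_def)
  qed
  have zero: "P 0"
    using elem[of "0 *\<^sub>C 0" 0] scale[of 0 0 0]
    by (simp only: complex_vector.scale_zero_left)
  have *: "P (abs_tensor f)" for f :: "'a \<times> 'b \<Rightarrow>\<^sub>0 complex"
  proof (induction f rule: update_induct)
    case const
    then show ?case using zero by (simp add: zero_tensor.abs_eq zero_tensor_def)
  next
    case (update f k c)
    obtain x y where k: "k = (x, y)" by (cases k)
    have "Poly_Mapping.update k c f = f + c *\<^sub>C formal_tensor x y"
      using update.hyps
      by (intro poly_mapping_eqI)
        (auto simp: lookup_update lookup_add lookup_scaleC lookup_single k when_def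
          scaleC_complex_def in_keys_iff)
    then have "abs_tensor (Poly_Mapping.update k c f) = abs_tensor f + (c *\<^sub>C x) \<otimes> y"
      by (simp only: scale plus_tensor.abs_eq[symmetric] scaleC_tensor.abs_eq[symmetric]
          tensor_of.abs_eq[symmetric])
    then show ?case using update.IH elem add by simp
  qed
  show ?thesis
    by (metis * Quotient3_abs_rep Quotient3_tensor)
qed

lemma tensor_lift_ex:
  fixes \<beta> :: "'a::complex_vector \<Rightarrow> 'b::complex_vector \<Rightarrow> 'c::complex_vector"
  assumes \<beta>: "cbilinear \<beta>"
  shows "\<exists>!f. clinear f \<and> (\<forall>x y. f (x \<otimes> y) = \<beta> x y)"
proof -
  let ?g = "\<lambda>f :: 'a \<times> 'b \<Rightarrow>\<^sub>0 complex.
    \<Sum>k\<in>Poly_Mapping.keys f. Poly_Mapping.lookup f k *\<^sub>C \<beta> (fst k) (snd k)"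
  have g: "?g f = (\<Sum>k\<in>S. Poly_Mapping.lookup f k *\<^sub>C \<beta> (fst k) (snd k))"
    if "finite S" "Poly_Mapping.keys f \<subseteq> S" for S f
    using that by (intro sum.mono_neutral_left) (auto simp: in_keys_iff)
  have lin: "clinear ?g"
  proof (rule clinearI)
    show "?g (f + h) = ?g f + ?g h" for f h
    proof -
      let ?S = "Poly_Mapping.keys f \<union> Poly_Mapping.keys h"
      have "?g (f + h) = (\<Sum>k\<in>?S. Poly_Mapping.lookup (f + h) k *\<^sub>C \<beta> (fst k) (snd k))"
        "?g f = (\<Sum>k\<in>?S. Poly_Mapping.lookup f k *\<^sub>C \<beta> (fst k) (snd k))"
        "?g h = (\<Sum>k\<in>?S. Poly_Mapping.lookup h k *\<^sub>C \<beta> (fst k) (snd k))"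
        using Poly_Mapping.keys_add[of f h] by (intro g; simp)+
      then show ?thesis
        by (simp only: lookup_add scaleC_add_left sum.distrib)
    qed
    show "?g (a *\<^sub>C f) = a *\<^sub>C ?g f" for a f
    proof -
      have "Poly_Mapping.keys (a *\<^sub>C f) \<subseteq> Poly_Mapping.keys f"
        by (auto simp: in_keys_iff lookup_scaleC)
      then have "?g (a *\<^sub>C f) =
          (\<Sum>k\<in>Poly_Mapping.keys f. Poly_Mapping.lookup (a *\<^sub>C f) k *\<^sub>C \<beta> (fst k) (snd k))"
        by (intro g) simp_all
      then show ?thesis
        by (simp only: lookup_scaleC scaleC_complex_def scaleC_scaleC
            complex_vector.scale_sum_right)
    qed
  qed
  have formal: "?g (formal_tensor x y) = \<beta> x y" for x y
    by (simp add: scaleC_one)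
  have bil: "\<beta> (x + x') y = \<beta> x y + \<beta> x' y" "\<beta> x (y + y') = \<beta> x y + \<beta> x y'"
    "\<beta> (a *\<^sub>C x) y = a *\<^sub>C \<beta> x y" "\<beta> x (a *\<^sub>C y) = a *\<^sub>C \<beta> x y" for x x' y y' a
    using \<beta> clinear_add[of "\<lambda>x. \<beta> x y" for y] clinear_scaleC[of "\<lambda>x. \<beta> x y" for y]
      clinear_add[of "\<beta> x" for x] clinear_scaleC[of "\<beta> x" for x]
    unfolding cbilinear_def by blast+
  have kills: "?g r = 0" if "r \<in> cspan bilinearity_relators" for r
    using that
  proof (rule complex_vector.span_induct)
    show "complex_vector.subspace {r. ?g r = 0}"
      using clinear_add[OF lin] clinear_scaleC[OF lin]
      by (intro complex_vector.subspaceI) simp_all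
    show "?g r = 0" if "r \<in> bilinearity_relators" for r
      using that unfolding bilinearity_relators_def
      by (elim UnE CollectE exE conjE; hypsubst;
          simp only: clinear_diff[OF lin] clinear_scaleC[OF lin] formal bil; simp)
  qed
  let ?f = "\<lambda>t. ?g (rep_tensor t)"
  have abs: "?f (abs_tensor r) = ?g r" for r
  proof -
    have "tensor_rel (rep_tensor (abs_tensor r)) r"
      by (rule Quotient3_rep_abs[OF Quotient3_tensor]) (rule tensor_rel_refl)
    then show ?thesis
      using kills[of "rep_tensor (abs_tensor r) - r"] unfolding tensor_rel_def
      by (simp only: clinear_diff[OF lin]) simp
  qed
  have ex: "\<exists>r. t = abs_tensor r" for t :: "('a, 'b) tensor"
    by (metis Quotient3_abs_rep Quotient3_tensor)
  have "clinear ?f"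
  proof (rule clinearI)
    show "?f (s + t) = ?f s + ?f t" for s t
      using ex[of s] ex[of t] by (elim exE) (simp only: plus_tensor.abs_eq abs clinear_add[OF lin])
    show "?f (a *\<^sub>C t) = a *\<^sub>C ?f t" for a t
      using ex[of t] by (elim exE) (simp only: scaleC_tensor.abs_eq abs clinear_scaleC[OF lin])
  qed
  moreover have "?f (x \<otimes> y) = \<beta> x y" for x y
    by (simp only: tensor_of.abs_eq abs formal)
  moreover have "f = h"
    if "clinear f \<and> (\<forall>x y. f (x \<otimes> y) = \<beta> x y)" "clinear h \<and> (\<forall>x y. h (x \<otimes> y) = \<beta> x y)"
    for f h
  proof
    show "f t = h t" for t
      using that by (induction t) (simp_all add: clinear_add)
  qed
  ultimately show ?thesis
    by (intro ex_ex1I) blast+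
qed

lemma clinear_tensor_lift: "cbilinear \<beta> \<Longrightarrow> clinear (tensor_lift \<beta>)"
  and tensor_lift_tensor_of: "cbilinear \<beta> \<Longrightarrow> tensor_lift \<beta> (x \<otimes> y) = \<beta> x y"
  using theI'[OF tensor_lift_ex, of \<beta>] unfolding tensor_lift_def by blast+


section \<open>Amplification, supports and $PL$-spaces\<close>

text \<open>
  \<open>H \<otimes> E\<close> is the type \<open>('h, 'e) tensor\<close>. A $PL$-space is a complex linear space \<open>'e\<close> together
  with a function \<open>N :: ('h, 'e) tensor \<Rightarrow> real\<close> satisfying \<open>PL_norm N\<close>.
\<close>

definition amplification ::
    "('e::complex_vector \<Rightarrow> 'f::complex_vector) \<Rightarrow> ('h::complex_vector, 'e) tensor \<Rightarrow> ('h, 'f) tensor"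
  where "amplification \<phi> = tensor_lift (\<lambda>\<xi> x. \<xi> \<otimes> \<phi> x)"

definition act ::
    "('h::complex_vector \<Rightarrow> 'h) \<Rightarrow> ('h, 'e::complex_vector) tensor \<Rightarrow> ('h, 'e) tensor"
  where "act a = tensor_lift (\<lambda>\<xi> x. a \<xi> \<otimes> x)"

definition is_norm :: "('a::complex_vector \<Rightarrow> real) \<Rightarrow> bool"
  where "is_norm p \<longleftrightarrow>
    (\<forall>x. p x = 0 \<longleftrightarrow> x = 0) \<and> (\<forall>x y. p (x + y) \<le> p x + p y) \<and> (\<forall>a x. p (a *\<^sub>C x) = cmod a * p x)"

definition PL_norm :: "(('h::complex_hilbert, 'e::complex_vector) tensor \<Rightarrow> real) \<Rightarrow> bool"
  where "PL_norm N \<longleftrightarrow>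
    is_norm N \<and> (\<forall>a u. bounded_clinear a \<longrightarrow> N (act a u) \<le> onorm a * N u)"

definition underlying_norm ::
    "(('h::complex_hilbert, 'e::complex_vector) tensor \<Rightarrow> real) \<Rightarrow> 'e \<Rightarrow> real"
  where "underlying_norm N x = N ((SOME \<xi>. norm \<xi> = 1) \<otimes> x)"

definition L_isometric_isomorphism ::
    "(('h::complex_hilbert, 'e::complex_vector) tensor \<Rightarrow> real) \<Rightarrow>
     (('h, 'f::complex_vector) tensor \<Rightarrow> real) \<Rightarrow> ('e \<Rightarrow> 'f) \<Rightarrow> bool"
  where "L_isometric_isomorphism N M \<phi> \<longleftrightarrow>
    PL_norm N \<and> PL_norm M \<and> clinear \<phi> \<and>
    bij (amplification \<phi> :: ('h, 'e) tensor \<Rightarrow> ('h, 'f) tensor) \<and>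
    (\<forall>u. M (amplification \<phi> u) = N u)"

definition support ::
    "('h::complex_inner \<Rightarrow> 'h) \<Rightarrow> ('h, 'e::complex_vector) tensor \<Rightarrow> bool"
  where "support P u \<longleftrightarrow> projection P \<and> act P u = u"


section \<open>Injective and Hilbert tensor norms\<close>

definition injective_norm ::
    "('a::complex_vector \<Rightarrow> real) \<Rightarrow> ('b::complex_vector \<Rightarrow> real) \<Rightarrow> ('a, 'b) tensor \<Rightarrow> real"
  where "injective_norm p q u =
    Sup {cmod (tensor_lift (\<lambda>x y. f x * g y) u) | f g.
      clinear f \<and> clinear g \<and> (\<forall>x. cmod (f x) \<le> p x) \<and> (\<forall>y. cmod (g y) \<le> q y)}"

definition minimal_L_norm ::
    "('e::complex_vector \<Rightarrow> real) \<Rightarrow> ('h::complex_hilbert, 'e) tensor \<Rightarrow> real"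
  where "minimal_L_norm q = injective_norm norm q"

text \<open>
  The sesquilinear extension of \<open>\<langle>x \<otimes> y, x' \<otimes> y'\<rangle> = \<langle>x, x'\<rangle> \<langle>y, y'\<rangle>\<close>. Since \<open>tensor_lift\<close> needs
  bilinear arguments, the inner lift computes \<open>\<langle>v, x \<otimes> y\<rangle>\<close>, which is linear in \<open>v\<close>.
\<close>

definition hil_inner ::
    "('k::complex_inner, 'l::complex_inner) tensor \<Rightarrow> ('k, 'l) tensor \<Rightarrow> complex"
  where "hil_inner u v =
    tensor_lift (\<lambda>x y. cnj (tensor_lift (\<lambda>x' y'. cinner x' x * cinner y' y) v)) u"

definition hil_norm :: "('k::complex_inner, 'l::complex_inner) tensor \<Rightarrow> real"
  where "hil_norm u = sqrt (Re (hil_inner u u))"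


section \<open>Completions\<close>

text \<open>
  A completion of the normed space \<open>('e, p)\<close> is a Banach space with a linear isometry of
  \<open>('e, p)\<close> onto a dense subspace; it is unique up to isometric isomorphism.
\<close>

definition completion_of ::
    "('e::complex_vector \<Rightarrow> real) \<Rightarrow> ('e \<Rightarrow> 'c::{complex_normed_vector, complete_space}) \<Rightarrow> bool"
  where "completion_of p j \<longleftrightarrow>
    clinear j \<and> (\<forall>x. norm (j x) = p x) \<and> closure (range j) = UNIV"

text \<open>
  For the completion \<open>j :: 'e \<Rightarrow> 'c\<close> of a $PL$-space \<open>('e, N)\<close>: the norm on \<open>H \<otimes> 'c\<close> induced by
  the embedding into the completion of \<open>H \<otimes> 'e\<close>. The image of \<open>\<Sum>i<n. \<xi> i \<otimes> x i\<close> is the limit of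
  \<open>\<Sum>i<n. \<xi> i \<otimes> s i m\<close> as \<open>m \<rightarrow> \<infinity>\<close>, where \<open>s i\<close> is a sequence in \<open>'e\<close> converging to \<open>x i\<close>, and
  its norm is the limit of the norms.
\<close>

definition completion_PL_norm ::
    "(('h::complex_hilbert, 'e::complex_vector) tensor \<Rightarrow> real) \<Rightarrow>
     ('e \<Rightarrow> 'c::{complex_normed_vector, complete_space}) \<Rightarrow> ('h, 'c) tensor \<Rightarrow> real"
  where "completion_PL_norm N j u = (THE r.
    \<forall>(n::nat) (\<xi> :: nat \<Rightarrow> 'h) (x :: nat \<Rightarrow> 'c) (s :: nat \<Rightarrow> nat \<Rightarrow> 'e).
      u = (\<Sum>i<n. \<xi> i \<otimes> x i) \<and> (\<forall>i<n. (\<lambda>m. j (s i m)) \<longlonglongrightarrow> x i) \<longrightarrow>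
      (\<lambda>m. N (\<Sum>i<n. \<xi> i \<otimes> s i m)) \<longlonglongrightarrow> r)"


section \<open>The $l$-tensor product\<close>

text \<open>The element \<open>u \<diamondsuit> v\<close>, for a bilinear operation \<open>d \<xi> \<eta> = \<xi> \<diamondsuit> \<eta>\<close> on \<open>H\<close>.\<close>

definition diamond ::
    "('h::complex_vector \<Rightarrow> 'h \<Rightarrow> 'h) \<Rightarrow>
     ('h, 'e::complex_vector) tensor \<Rightarrow> ('h, 'f::complex_vector) tensor \<Rightarrow> ('h, ('e, 'f) tensor) tensor"
  where "diamond d u v =
    tensor_lift (\<lambda>\<xi> x. tensor_lift (\<lambda>\<eta> y. d \<xi> \<eta> \<otimes> (x \<otimes> y)) v) u"

definition l_norm ::
    "('h::complex_hilbert \<Rightarrow> 'h \<Rightarrow> 'h) \<Rightarrow>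
     (('h, 'e::complex_vector) tensor \<Rightarrow> real) \<Rightarrow> (('h, 'f::complex_vector) tensor \<Rightarrow> real) \<Rightarrow>
     ('h, ('e, 'f) tensor) tensor \<Rightarrow> real"
  where "l_norm d N M U =
    Inf {onorm a * sqrt (\<Sum>k=1..n. (N (u k))\<^sup>2 * (M (v k))\<^sup>2) | a (n::nat) u v.
      bounded_clinear a \<and>
      (\<exists>P. (\<forall>k\<in>{1..n}. support (P k) (u k)) \<and>
           (\<forall>j\<in>{1..n}. \<forall>k\<in>{1..n}. j \<noteq> k \<longrightarrow> (\<forall>\<xi>. P j (P k \<xi>) = 0))) \<and>
      U = act a (\<Sum>k=1..n. diamond d (u k) (v k))}"

end

theory Submission
  imports Defs
begin

text \<open>
  For a pre-Hilbert space \<open>K\<close>, an element \<open>u\<close> of \<open>H \<otimes> K\<close> acts as the antilinear finite-rank operator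
  \<open>y \<mapsto> slice y u\<close> from \<open>K\<close> to \<open>H\<close>, and the minimal norm of \<open>u\<close> is its operator norm. Under this
  identification \<open>u \<diamondsuit> v\<close> becomes the Hilbert tensor product of two operators, whose norm is the
  product of their norms, and orthogonal supports give orthogonal ranges; with Pythagoras this
  bounds the minimal norm on \<open>H \<otimes> (K \<otimes> L)\<close> by the \<open>l\<close>-norm. Conversely, write
  \<open>U = \<Sum> \<zeta> i j \<otimes> (e i \<otimes> f j)\<close> with orthonormal \<open>e\<close>, \<open>f\<close>, choose an orthonormal sequence \<open>\<xi>\<close> in \<open>H\<close>, and
  put \<open>u = \<Sum> \<xi> i \<otimes> e i\<close>, \<open>v = \<Sum> \<xi> j \<otimes> f j\<close>. These have norm at most 1, and \<open>U = a \<cdot> (u \<diamondsuit> v)\<close> where \<open>a\<close>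
  sends \<open>\<xi> i \<diamondsuit> \<xi> j\<close> to \<open>\<zeta> i j\<close> and has the norm of the operator given by \<open>U\<close>. So the two norms
  coincide, and the completed statement follows by extending isometries to completions.
\<close>

section \<open>Tensors and complex inner product spaces\<close>

lemma tensor_add_left: "(x + x') \<otimes> y = x \<otimes> y + x' \<otimes> y"
proof (transfer fixing: x x' y)
  show "tensor_rel (formal_tensor (x + x') y) (formal_tensor x y + formal_tensor x' y)"
    unfolding tensor_rel_def diff_diff_eq[symmetric]
    unfolding bilinearity_relators_def by (rule complex_vector.span_base) blast
qed

lemma tensor_add_right: "x \<otimes> (y + y') = x \<otimes> y + x \<otimes> y'"
proof (transfer fixing: x y y')
  show "tensor_rel (formal_tensor x (y + y')) (formal_tensor x y + formal_tensor x y')"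
    unfolding tensor_rel_def diff_diff_eq[symmetric]
    unfolding bilinearity_relators_def by (rule complex_vector.span_base) blast
qed

lemma tensor_scaleC_left: "(a *\<^sub>C x) \<otimes> y = a *\<^sub>C (x \<otimes> y)"
proof (transfer fixing: a x y)
  show "tensor_rel (formal_tensor (a *\<^sub>C x) y) (a *\<^sub>C formal_tensor x y)"
    unfolding tensor_rel_def
    unfolding bilinearity_relators_def by (rule complex_vector.span_base) blast
qed

lemma tensor_scaleC_right: "x \<otimes> (a *\<^sub>C y) = a *\<^sub>C (x \<otimes> y)"
proof (transfer fixing: a x y)
  show "tensor_rel (formal_tensor x (a *\<^sub>C y)) (a *\<^sub>C formal_tensor x y)"
    unfolding tensor_rel_def
    unfolding bilinearity_relators_def by (rule complex_vector.span_base) blast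
qed

lemma clinear_tensor_left: "clinear (\<lambda>x. x \<otimes> y)"
  by (rule clinearI) (simp_all add: tensor_add_left tensor_scaleC_left)

lemma clinear_tensor_right: "clinear (\<lambda>y. x \<otimes> y)"
  by (rule clinearI) (simp_all add: tensor_add_right tensor_scaleC_right)

lemmas tensor_sum_left = clinear_sum[OF clinear_tensor_left]
  and tensor_sum_right = clinear_sum[OF clinear_tensor_right]
  and tensor_diff_right = clinear_diff[OF clinear_tensor_right]

lemma scaleC_zero_right [simp]: "a *\<^sub>C (0 :: 'a::complex_vector) = 0"
  by (rule complex_vector.scale_zero_right)

lemma scaleC_zero_left [simp]: "0 *\<^sub>C (x :: 'a::complex_vector) = 0"
  by (rule complex_vector.scale_zero_left)

lemma clinear_0: "clinear f \<Longrightarrow> f 0 = 0"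
  using clinear_scaleC[of f 0 0] by simp

lemma clinear_compose: "clinear f \<Longrightarrow> clinear g \<Longrightarrow> clinear (\<lambda>x. g (f x))"
  by (rule clinearI) (simp_all add: clinear_add clinear_scaleC)

lemma cbilinearI:
  assumes "\<And>x x' y. \<beta> (x + x') y = \<beta> x y + \<beta> x' y" "\<And>a x y. \<beta> (a *\<^sub>C x) y = a *\<^sub>C \<beta> x y"
    and "\<And>x y y'. \<beta> x (y + y') = \<beta> x y + \<beta> x y'" "\<And>a x y. \<beta> x (a *\<^sub>C y) = a *\<^sub>C \<beta> x y"
  shows "cbilinear \<beta>"
  unfolding cbilinear_def using assms by (auto intro!: clinearI)

text \<open>Elementary tensors generate the tensor product under addition alone, scalars being
  absorbed into a factor, so additivity carries the induction.\<close>

lemma clinear_eq_on_tensors: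
  assumes "clinear f" "clinear g" "\<And>x y. f (x \<otimes> y) = g (x \<otimes> y)"
  shows "f u = g u"
  by (induction u) (simp_all add: assms clinear_add)

text \<open>A map given by \<open>tensor_lift\<close> is a mere definite description until
  bilinearity is checked. Linearity and the value on elementary tensors are then what the proofs
  use; the other lifted maps below are opened up in the same way.\<close>

lemma clinear_amplification: "clinear \<phi> \<Longrightarrow> clinear (amplification \<phi>)"
  and amplification_tensor_of: "clinear \<phi> \<Longrightarrow> amplification \<phi> (\<xi> \<otimes> x) = \<xi> \<otimes> \<phi> x"
proof -
  assume "clinear \<phi>"
  then have "cbilinear (\<lambda>\<xi> x. \<xi> \<otimes> \<phi> x)"
    by (intro cbilinearI) (simp_all add: tensor_add_left tensor_add_right tensor_scaleC_left
        tensor_scaleC_right clinear_add clinear_scaleC)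
  then show "clinear (amplification \<phi>)" "amplification \<phi> (\<xi> \<otimes> x) = \<xi> \<otimes> \<phi> x"
    unfolding amplification_def by (rule clinear_tensor_lift, rule tensor_lift_tensor_of)
qed

lemma amplification_comp:
  fixes u :: "('h::complex_vector, 'a::complex_vector) tensor"
  assumes "clinear f" "clinear g"
  shows "amplification g (amplification f u) = amplification (\<lambda>x. g (f x)) u"
proof (rule clinear_eq_on_tensors[of "\<lambda>u. amplification g (amplification f u)"])
  note gf = clinear_compose[OF assms]
  show "clinear (\<lambda>u :: ('h, 'a) tensor. amplification g (amplification f u))"
    by (rule clinear_compose[OF clinear_amplification clinear_amplification]) (rule assms)+
  show "clinear (amplification (\<lambda>x. g (f x)) :: ('h, 'a) tensor \<Rightarrow> _)"
    by (rule clinear_amplification[OF gf])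
  show "amplification g (amplification f (\<xi> \<otimes> x)) = amplification (\<lambda>x. g (f x)) (\<xi> \<otimes> x)"
    for \<xi> :: 'h and x
    by (simp only: amplification_tensor_of[OF gf] amplification_tensor_of[OF assms(1)]
        amplification_tensor_of[OF assms(2)])
qed

lemma amplification_id: "amplification (\<lambda>x. x) u = u"
proof (rule clinear_eq_on_tensors[of "amplification (\<lambda>x. x)" "\<lambda>x. x"])
  have id: "clinear (\<lambda>x :: 'c::complex_vector. x)" by (rule clinearI) (rule refl)+
  show "clinear (amplification (\<lambda>x :: 'b. x) :: ('a, 'b) tensor \<Rightarrow> _)" "clinear (\<lambda>x :: ('a, 'b) tensor. x)"
    by (rule clinear_amplification[OF id] id)+
  show "amplification (\<lambda>x. x) (\<xi> \<otimes> x) = \<xi> \<otimes> x" for \<xi> :: 'a and x :: 'b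
    by (rule amplification_tensor_of[OF id])
qed

lemma clinear_act: "clinear a \<Longrightarrow> clinear (act a)"
  and act_tensor_of: "clinear a \<Longrightarrow> act a (\<xi> \<otimes> x) = a \<xi> \<otimes> x"
proof -
  assume "clinear a"
  then have "cbilinear (\<lambda>\<xi> x. a \<xi> \<otimes> x)"
    by (intro cbilinearI) (simp_all add: tensor_add_left tensor_add_right tensor_scaleC_left
        tensor_scaleC_right clinear_add clinear_scaleC)
  then show "clinear (act a)" "act a (\<xi> \<otimes> x) = a \<xi> \<otimes> x"
    unfolding act_def by (rule clinear_tensor_lift, rule tensor_lift_tensor_of)
qed

section \<open>Inner products: orthonormal sums, Bessel's inequality, polarization\<close>

lemma cinner_add_right: "cinner x (y + z) = cinner x y + cinner x z"
  by (metis cinner_add_left cinner_commute complex_cnj_add)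

lemma cinner_scaleC_right: "cinner x (a *\<^sub>C y) = cnj a * cinner x y"
  by (metis cinner_scaleC_left cinner_commute complex_cnj_mult)

lemma clinear_cinner: "clinear (\<lambda>x. cinner x y)"
  by (rule clinearI) (simp_all add: cinner_add_left cinner_scaleC_left scaleC_complex_def)

lemmas cinner_sum_left = clinear_sum[OF clinear_cinner]
  and cinner_zero_left [simp] = clinear_0[OF clinear_cinner]
  and cinner_diff_left = clinear_diff[OF clinear_cinner]

lemma cinner_sum_right: "cinner x (\<Sum>i\<in>I. g i) = (\<Sum>i\<in>I. cinner x (g i))"
  unfolding cinner_commute[of x] by (simp add: cinner_sum_left)

lemma cinner_zero_right [simp]: "cinner x 0 = 0"
  by (metis cinner_commute cinner_zero_left complex_cnj_zero)

text \<open>A family over an index set rather than a set of vectors, so that one notion serves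
  initial segments of the naturals, products of two of them and a single vector.\<close>

definition orthonormal_on :: "'i set \<Rightarrow> ('i \<Rightarrow> 'a::complex_inner) \<Rightarrow> bool"
  where "orthonormal_on I e \<longleftrightarrow> (\<forall>i\<in>I. \<forall>j\<in>I. cinner (e i) (e j) = of_bool (i = j))"

lemma cinner_orthonormal_sum_left:
  assumes "finite I" "orthonormal_on I e" "j \<in> I"
  shows "cinner (\<Sum>i\<in>I. c i *\<^sub>C e i) (e j) = c j"
proof -
  have "cinner (\<Sum>i\<in>I. c i *\<^sub>C e i) (e j) = (\<Sum>i\<in>I. if i = j then c i else 0)"
    unfolding cinner_sum_left cinner_scaleC_left
    using assms by (intro sum.cong) (auto simp: orthonormal_on_def)
  then show ?thesis using assms by simp
qed

lemma cinner_orthonormal_sum_right: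
  assumes "finite I" "orthonormal_on I e" "j \<in> I"
  shows "cinner (e j) (\<Sum>i\<in>I. c i *\<^sub>C e i) = cnj (c j)"
  using cinner_orthonormal_sum_left[OF assms] by (metis cinner_commute)

lemma norm_orthonormal_sum:
  assumes "finite I" "orthonormal_on I e"
  shows "(norm (\<Sum>i\<in>I. c i *\<^sub>C e i))\<^sup>2 = (\<Sum>i\<in>I. (cmod (c i))\<^sup>2)"
proof -
  let ?x = "\<Sum>i\<in>I. c i *\<^sub>C e i"
  have "complex_of_real ((norm ?x)\<^sup>2) = cinner ?x ?x"
    by (rule cinner_self[symmetric])
  also have "\<dots> = (\<Sum>i\<in>I. c i * cnj (c i))"
    by (subst cinner_sum_left, rule sum.cong)
      (simp_all add: cinner_scaleC_left cinner_orthonormal_sum_right[OF assms])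
  also have "\<dots> = complex_of_real (\<Sum>i\<in>I. (cmod (c i))\<^sup>2)"
    by (simp add: complex_norm_square del: of_real_power)
  finally show ?thesis by (simp only: of_real_eq_iff)
qed

lemma pythagoras:
  assumes "finite I" "\<And>i j. i \<in> I \<Longrightarrow> j \<in> I \<Longrightarrow> i \<noteq> j \<Longrightarrow> cinner (x i) (x j) = 0"
  shows "(norm (\<Sum>i\<in>I. x i))\<^sup>2 = (\<Sum>i\<in>I. (norm (x i))\<^sup>2)"
proof -
  have "complex_of_real ((norm (\<Sum>i\<in>I. x i))\<^sup>2) = (\<Sum>i\<in>I. \<Sum>j\<in>I. cinner (x i) (x j))"
    by (simp only: cinner_self[symmetric] cinner_sum_left, subst cinner_sum_right, rule refl)
  also have "\<dots> = (\<Sum>i\<in>I. \<Sum>j\<in>I. if i = j then cinner (x i) (x i) else 0)"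
    using assms by (intro sum.cong) auto
  also have "\<dots> = complex_of_real (\<Sum>i\<in>I. (norm (x i))\<^sup>2)"
    using assms(1) by (simp add: cinner_self)
  finally show ?thesis by (simp only: of_real_eq_iff)
qed

lemma bessel:
  assumes "finite I" "orthonormal_on I e"
  shows "(\<Sum>i\<in>I. (cmod (cinner x (e i)))\<^sup>2) \<le> (norm x)\<^sup>2"
proof -
  \<comment> \<open>The orthogonal projection of \<open>x\<close> onto the span of the family. The
    remainder \<open>x - p\<close> is orthogonal to it, and Pythagoras for
    \<open>x = (x - p) + p\<close> gives the bound.\<close>
  define p where "p = (\<Sum>i\<in>I. cinner x (e i) *\<^sub>C e i)"
  have "cinner (x - p) (e i) = 0" if "i \<in> I" for i
    using that by (simp add: p_def cinner_diff_left cinner_orthonormal_sum_left[OF assms])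
  then have "cinner (x - p) p = 0"
    by (subst (2) p_def) (simp add: cinner_sum_right cinner_scaleC_right)
  moreover from this have "cinner p (x - p) = 0"
    by (metis cinner_commute complex_cnj_zero)
  ultimately have "cinner ((x - p) + p) ((x - p) + p) = cinner (x - p) (x - p) + cinner p p"
    unfolding cinner_add_left cinner_add_right by simp
  then have "cinner x x = cinner (x - p) (x - p) + cinner p p" by simp
  then have "(norm x)\<^sup>2 = (norm (x - p))\<^sup>2 + (norm p)\<^sup>2"
    by (simp only: cinner_self of_real_add[symmetric] of_real_eq_iff)
  then show ?thesis
    using norm_orthonormal_sum[OF assms, of "\<lambda>i. cinner x (e i)"] by (simp add: p_def)
qed

text \<open>Bessel's inequality for the single unit vector in the direction of
  \<open>y\<close>.\<close>

lemma cauchy_schwarz: "cmod (cinner x y) \<le> norm x * norm y"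
proof (cases "y = 0")
  case False
  define e where "e = complex_of_real (1 / norm y) *\<^sub>C y"
  have e: "orthonormal_on {()} (\<lambda>_. e)"
    using False by (simp add: orthonormal_on_def e_def cinner_self norm_scaleC norm_divide)
  have "(cmod (cinner x e))\<^sup>2 \<le> (norm x)\<^sup>2"
    using bessel[OF _ e, of x] by simp
  then have "cmod (cinner x e) \<le> norm x" by simp
  then show ?thesis
    using False by (simp add: e_def cinner_scaleC_right norm_mult norm_divide field_simps)
qed simp

text \<open>Polarization: norms determine the real part of the inner product, and the imaginary part
  is, up to sign, the real part with \<open>\<i> *\<^sub>C x\<close> in place of \<open>x\<close>.
  Completions are given by norm-preserving maps; this recovers their inner products.\<close>

lemma clinear_isometry_cinner:
  fixes f :: "'a::complex_inner \<Rightarrow> 'b::complex_inner"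
  assumes f: "clinear f" and iso: "\<And>x. norm (f x) = norm x"
  shows "cinner (f x) (f y) = cinner x y"
proof -
  have Re: "2 * Re (cinner x y) = (norm (x + y))\<^sup>2 - (norm x)\<^sup>2 - (norm y)\<^sup>2"
    for x y :: "'c::complex_inner"
  proof -
    have "Re (cinner (x + y) (x + y)) = Re (cinner x x) + Re (cinner y y) + 2 * Re (cinner x y)"
      using cinner_commute[of y x] by (simp add: cinner_add_left cinner_add_right)
    then show ?thesis by (simp add: cinner_self)
  qed
  have "Re (cinner (f x) (f y)) = Re (cinner x y)" for x y
    using Re[of "f x" "f y"] Re[of x y] by (simp add: clinear_add[OF f, symmetric] iso)
  from this[of x y] this[of "\<i> *\<^sub>C x" y] show ?thesis
    by (simp add: complex_eq_iff clinear_scaleC[OF f] cinner_scaleC_left)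
qed

section \<open>Orthonormalization\<close>

definition covers :: "'i set \<Rightarrow> ('i \<Rightarrow> 'a::complex_inner) \<Rightarrow> 'a set \<Rightarrow> bool"
  where "covers I e A \<longleftrightarrow> (\<forall>x\<in>A. x = (\<Sum>i\<in>I. cinner x (e i) *\<^sub>C e i))"

text \<open>One Gram-Schmidt step: the residual of \<open>x\<close> after projection is nonzero by
  assumption, and \<open>v\<close> is its normalization. It serves both to orthonormalize a finite
  set and to build long orthonormal families.\<close>

lemma orthonormal_extend:
  fixes e :: "nat \<Rightarrow> 'a::complex_inner"
  assumes e: "orthonormal_on {..<n} e" and x: "x \<noteq> (\<Sum>i<n. cinner x (e i) *\<^sub>C e i)"
  obtains v where "orthonormal_on {..<Suc n} (e(n := v))"
    "x = (\<Sum>i<Suc n. cinner x ((e(n := v)) i) *\<^sub>C (e(n := v)) i)"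
proof -
  define p where "p = (\<Sum>i<n. cinner x (e i) *\<^sub>C e i)"
  define r where "r = norm (x - p)"
  define v where "v = complex_of_real (1 / r) *\<^sub>C (x - p)"
  have r: "r > 0" using x by (simp add: r_def p_def)
  have orth: "cinner (x - p) (e i) = 0" if "i < n" for i
    using that by (simp add: p_def cinner_diff_left cinner_orthonormal_sum_left[OF _ e])
  then have ve: "cinner v (e i) = 0" "cinner (e i) v = 0" if "i < n" for i
    using that cinner_commute[of "e i" v] by (simp_all add: v_def cinner_scaleC_left)
  have "cinner v v = 1"
    using r by (simp add: v_def cinner_self norm_scaleC norm_divide flip: r_def)
  then have on: "orthonormal_on {..<Suc n} (e(n := v))"
    using e ve by (auto simp: orthonormal_on_def less_Suc_eq)
  have "cinner p v = 0"
    by (simp add: p_def cinner_sum_left cinner_scaleC_left ve)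
  moreover have xp: "x - p = complex_of_real r *\<^sub>C v"
    using r by (simp add: v_def scaleC_scaleC scaleC_one flip: of_real_mult)
  ultimately have "cinner x v = complex_of_real r"
    using \<open>cinner v v = 1\<close> cinner_diff_left[of x p v] by (simp add: cinner_scaleC_left)
  then have "x = (\<Sum>i<Suc n. cinner x ((e(n := v)) i) *\<^sub>C (e(n := v)) i)"
    using xp by (simp add: p_def algebra_simps)
  with on that show ?thesis by blast
qed

text \<open>For an orthonormal family, covering \<open>A\<close> means that its span contains
  \<open>A\<close>, expressed through the coefficients. The vectors are inserted one at a time, and
  the family grows only when the new vector is not yet covered.\<close>

lemma gram_schmidt:
  fixes A :: "'a::complex_inner set"
  assumes "finite A"
  obtains n and e :: "nat \<Rightarrow> 'a" where "orthonormal_on {..<n} e" "covers {..<n} e A"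
proof -
  from assms have "\<exists>n. \<exists>e :: nat \<Rightarrow> 'a. orthonormal_on {..<n} e \<and> covers {..<n} e A"
  proof induction
    case empty
    have "orthonormal_on {..<0} (undefined :: nat \<Rightarrow> 'a) \<and> covers {..<0::nat} undefined {}"
      by (simp add: orthonormal_on_def covers_def)
    then show ?case by blast
  next
    case (insert x A)
    then obtain n and e :: "nat \<Rightarrow> 'a" where e: "orthonormal_on {..<n} e" and cov: "covers {..<n} e A"
      by blast
    show ?case
    proof (cases "x = (\<Sum>i<n. cinner x (e i) *\<^sub>C e i)")
      case True
      then show ?thesis using e cov unfolding covers_def by blast
    next
      case False
      from orthonormal_extend[OF e this] obtain v
        where v: "orthonormal_on {..<Suc n} (e(n := v))"
          and xv: "x = (\<Sum>i<Suc n. cinner x ((e(n := v)) i) *\<^sub>C (e(n := v)) i)" by blast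
      \<comment> \<open>Vectors already covered stay covered: their expansion is padded with the
        coefficient 0 at the new index, and coefficients along an orthonormal family are forced to
        be the inner products.\<close>
      have "y = (\<Sum>i<Suc n. cinner y ((e(n := v)) i) *\<^sub>C (e(n := v)) i)" if "y \<in> A" for y
      proof -
        have y: "y = (\<Sum>i<n. cinner y (e i) *\<^sub>C (e(n := v)) i)"
          using cov that by (simp add: covers_def)
        also have "\<dots> = (\<Sum>i<Suc n. (if i < n then cinner y (e i) else 0) *\<^sub>C (e(n := v)) i)"
          by simp
        finally have y': "y = (\<Sum>i<Suc n. (if i < n then cinner y (e i) else 0) *\<^sub>C (e(n := v)) i)" .
        have "cinner y ((e(n := v)) i) = (if i < n then cinner y (e i) else 0)" if "i < Suc n" for i
          by (subst y', subst cinner_orthonormal_sum_left[OF _ v]) (use that in simp_all)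
        then show ?thesis by (subst y') (auto intro!: sum.cong)
      qed
      with v xv show ?thesis unfolding covers_def by blast
    qed
  qed
  with that show ?thesis by blast
qed

lemma covers_Un: "covers I e (A \<union> B) \<longleftrightarrow> covers I e A \<and> covers I e B"
  unfolding covers_def by blast

text \<open>Finite families of every length are enough, since tensors have finite rank. A vector
  outside the span of a family cannot equal its projection, so \<open>orthonormal_extend\<close>
  applies.\<close>

lemma orthonormal_sequence_exists:
  assumes "\<not> (\<exists>B :: 'a::complex_inner set. finite B \<and> cspan B = UNIV)"
  shows "\<exists>e :: nat \<Rightarrow> 'a. orthonormal_on {..<n} e"
proof (induction n)
  case 0
  then show ?case by (simp add: orthonormal_on_def)
next
  case (Suc n)
  then obtain e :: "nat \<Rightarrow> 'a" where e: "orthonormal_on {..<n} e" by blast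
  have "cspan (e ` {..<n}) \<noteq> UNIV" using assms by blast
  then obtain x where "x \<notin> cspan (e ` {..<n})" by blast
  moreover have "(\<Sum>i<n. cinner x (e i) *\<^sub>C e i) \<in> cspan (e ` {..<n})"
    by (intro complex_vector.span_sum complex_vector.span_scale complex_vector.span_base) auto
  ultimately have "x \<noteq> (\<Sum>i<n. cinner x (e i) *\<^sub>C e i)" by metis
  from orthonormal_extend[OF e this] show ?case by blast
qed

section \<open>The Hilbert tensor product\<close>

text \<open>\<open>A\<close> collects the second factors of some representation of \<open>u\<close>.
  Quantifying over all covering families lets the induction pass to sums: a family that covers the
  union of two such sets expands both summands, whereas two chosen expansions would use unrelated
  families.\<close>

lemma tensor_orthonormal_support:
  fixes u :: "('a::complex_vector, 'k::complex_inner) tensor"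
  shows "\<exists>A. finite A \<and> (\<forall>n (e :: nat \<Rightarrow> 'k).
    covers {..<n} e A \<longrightarrow> (\<exists>\<xi>. u = (\<Sum>i<n. \<xi> i \<otimes> e i)))"
proof (induction u)
  case (tensor_of \<xi> x)
  have "\<exists>\<zeta>. \<xi> \<otimes> x = (\<Sum>i<n. \<zeta> i \<otimes> e i)" if cov: "covers {..<n} e {x}" for n and e :: "nat \<Rightarrow> 'k"
  proof -
    have "x = (\<Sum>i<n. cinner x (e i) *\<^sub>C e i)" using cov by (simp add: covers_def)
    then have "\<xi> \<otimes> x = \<xi> \<otimes> (\<Sum>i<n. cinner x (e i) *\<^sub>C e i)" by (rule arg_cong)
    also have "\<dots> = (\<Sum>i<n. (cinner x (e i) *\<^sub>C \<xi>) \<otimes> e i)"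
      by (simp add: tensor_sum_right tensor_scaleC_right tensor_scaleC_left)
    finally show ?thesis by (rule exI[of _ "\<lambda>i. cinner x (e i) *\<^sub>C \<xi>"])
  qed
  then show ?case by (intro exI[of _ "{x}"]) blast
next
  case (add s t)
  then obtain A B where A: "finite A" "\<And>n (e :: nat \<Rightarrow> 'k). covers {..<n} e A \<Longrightarrow> \<exists>\<xi>. s = (\<Sum>i<n. \<xi> i \<otimes> e i)"
    and B: "finite B" "\<And>n (e :: nat \<Rightarrow> 'k). covers {..<n} e B \<Longrightarrow> \<exists>\<xi>. t = (\<Sum>i<n. \<xi> i \<otimes> e i)"
    by blast
  have "\<exists>\<xi>. s + t = (\<Sum>i<n. \<xi> i \<otimes> e i)" if cov: "covers {..<n} e (A \<union> B)" for n and e :: "nat \<Rightarrow> 'k"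
  proof -
    obtain \<xi> \<eta> where "s = (\<Sum>i<n. \<xi> i \<otimes> e i)" "t = (\<Sum>i<n. \<eta> i \<otimes> e i)"
      using A(2) B(2) cov unfolding covers_Un by blast
    then have "s + t = (\<Sum>i<n. (\<xi> i + \<eta> i) \<otimes> e i)"
      by (simp add: tensor_add_left sum.distrib)
    then show ?thesis by (rule exI[of _ "\<lambda>i. \<xi> i + \<eta> i"])
  qed
  with A(1) B(1) show ?case by (intro exI[of _ "A \<union> B"]) blast
qed

lemma tensor_orthonormal_expansion:
  fixes u :: "('a::complex_vector, 'k::complex_inner) tensor"
  obtains n \<xi> and e :: "nat \<Rightarrow> 'k" where "orthonormal_on {..<n} e" "u = (\<Sum>i<n. \<xi> i \<otimes> e i)"
  using tensor_orthonormal_support[of u] gram_schmidt by metis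

text \<open>The coefficients are indexed by pairs, so that \<open>e i \<otimes> f j\<close> is one orthonormal family.\<close>

lemma tensor_product_support:
  fixes w :: "('k::complex_inner, 'l::complex_inner) tensor"
  shows "\<exists>A B. finite A \<and> finite B \<and> (\<forall>n (e :: nat \<Rightarrow> 'k) m (f :: nat \<Rightarrow> 'l).
    covers {..<n} e A \<longrightarrow> covers {..<m} f B \<longrightarrow>
    (\<exists>c. w = (\<Sum>(i, j)\<in>{..<n} \<times> {..<m}. c (i, j) *\<^sub>C (e i \<otimes> f j))))"
proof (induction w)
  case (tensor_of x y)
  have "\<exists>c. x \<otimes> y = (\<Sum>(i, j)\<in>{..<n} \<times> {..<m}. c (i, j) *\<^sub>C (e i \<otimes> f j))"
    if cov: "covers {..<n} e {x}" "covers {..<m} f {y}"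
    for n m and e :: "nat \<Rightarrow> 'k" and f :: "nat \<Rightarrow> 'l"
  proof -
    have "x = (\<Sum>i<n. cinner x (e i) *\<^sub>C e i)" "y = (\<Sum>j<m. cinner y (f j) *\<^sub>C f j)"
      using cov by (simp_all add: covers_def)
    then have "x \<otimes> y = (\<Sum>i<n. cinner x (e i) *\<^sub>C e i) \<otimes> (\<Sum>j<m. cinner y (f j) *\<^sub>C f j)"
      by (rule arg_cong2)
    also have "\<dots> = (\<Sum>i<n. \<Sum>j<m. (cinner x (e i) * cinner y (f j)) *\<^sub>C (e i \<otimes> f j))"
      by (subst tensor_sum_left, subst tensor_sum_right)
        (simp add: tensor_scaleC_left tensor_scaleC_right scaleC_scaleC
          complex_vector.scale_sum_right mult.commute)
    also have "\<dots> = (\<Sum>(i, j)\<in>{..<n} \<times> {..<m}. (cinner x (e i) * cinner y (f j)) *\<^sub>C (e i \<otimes> f j))"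
      by (rule sum.cartesian_product)
    finally show ?thesis
      by (intro exI[of _ "\<lambda>(i, j). cinner x (e i) * cinner y (f j)"]) simp
  qed
  then show ?case by (intro exI[of _ "{x}"] exI[of _ "{y}"]) blast
next
  case (add s t)
  let ?P = "\<lambda>w A B. (\<forall>n (e :: nat \<Rightarrow> 'k) m (f :: nat \<Rightarrow> 'l).
    covers {..<n} e A \<longrightarrow> covers {..<m} f B \<longrightarrow>
    (\<exists>c. w = (\<Sum>(i, j)\<in>{..<n} \<times> {..<m}. c (i, j) *\<^sub>C (e i \<otimes> f j))))"
  from add obtain A A' B B' where A: "finite A" "finite A'" "?P s A A'"
    and B: "finite B" "finite B'" "?P t B B'"
    by blast
  have "\<exists>c. s + t = (\<Sum>(i, j)\<in>{..<n} \<times> {..<m}. c (i, j) *\<^sub>C (e i \<otimes> f j))"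
    if cov: "covers {..<n} e (A \<union> B)" "covers {..<m} f (A' \<union> B')"
    for n m and e :: "nat \<Rightarrow> 'k" and f :: "nat \<Rightarrow> 'l"
  proof -
    obtain c c' where "s = (\<Sum>(i, j)\<in>{..<n} \<times> {..<m}. c (i, j) *\<^sub>C (e i \<otimes> f j))"
      "t = (\<Sum>(i, j)\<in>{..<n} \<times> {..<m}. c' (i, j) *\<^sub>C (e i \<otimes> f j))"
      using A(3)[rule_format, of n e m f] B(3)[rule_format, of n e m f] cov
      unfolding covers_Un by blast
    then have "s + t = (\<Sum>(i, j)\<in>{..<n} \<times> {..<m}. (c (i, j) + c' (i, j)) *\<^sub>C (e i \<otimes> f j))"
      by (simp add: scaleC_add_left sum.distrib case_prod_unfold)
    then show ?thesis by (rule exI[of _ "\<lambda>p. c p + c' p"])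
  qed
  with A(1,2) B(1,2) show ?case by (intro exI[of _ "A \<union> B"] exI[of _ "A' \<union> B'"]) blast
qed

text \<open>Once \<open>tensor_product_support\<close> has expanded the second factor, the scalars
  move onto the first one, so that the coefficients become vectors.\<close>

lemma triple_tensor_support:
  fixes U :: "('a::complex_vector, ('k::complex_inner, 'l::complex_inner) tensor) tensor"
  shows "\<exists>A B. finite A \<and> finite B \<and> (\<forall>n (e :: nat \<Rightarrow> 'k) m (f :: nat \<Rightarrow> 'l).
    covers {..<n} e A \<longrightarrow> covers {..<m} f B \<longrightarrow>
    (\<exists>\<zeta>. U = (\<Sum>(i, j)\<in>{..<n} \<times> {..<m}. \<zeta> (i, j) \<otimes> (e i \<otimes> f j))))"
proof (induction U)
  case (tensor_of \<xi> w)
  from tensor_product_support[of w] obtain A B where AB: "finite A" "finite B"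
    and w: "\<And>n (e :: nat \<Rightarrow> 'k) m (f :: nat \<Rightarrow> 'l).
      covers {..<n} e A \<Longrightarrow> covers {..<m} f B \<Longrightarrow>
      \<exists>c. w = (\<Sum>(i, j)\<in>{..<n} \<times> {..<m}. c (i, j) *\<^sub>C (e i \<otimes> f j))"
    by blast
  have "\<exists>\<zeta>. \<xi> \<otimes> w = (\<Sum>(i, j)\<in>{..<n} \<times> {..<m}. \<zeta> (i, j) \<otimes> (e i \<otimes> f j))"
    if cov: "covers {..<n} e A" "covers {..<m} f B"
    for n m and e :: "nat \<Rightarrow> 'k" and f :: "nat \<Rightarrow> 'l"
  proof -
    obtain c where "w = (\<Sum>(i, j)\<in>{..<n} \<times> {..<m}. c (i, j) *\<^sub>C (e i \<otimes> f j))"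
      using w[OF cov] by blast
    then have "\<xi> \<otimes> w = (\<Sum>(i, j)\<in>{..<n} \<times> {..<m}. (c (i, j) *\<^sub>C \<xi>) \<otimes> (e i \<otimes> f j))"
      by (simp add: tensor_sum_right tensor_scaleC_right tensor_scaleC_left case_prod_unfold)
    then show ?thesis by (rule exI[of _ "\<lambda>p. c p *\<^sub>C \<xi>"])
  qed
  with AB show ?case by blast
next
  case (add s t)
  let ?P = "\<lambda>w A B. (\<forall>n (e :: nat \<Rightarrow> 'k) m (f :: nat \<Rightarrow> 'l).
    covers {..<n} e A \<longrightarrow> covers {..<m} f B \<longrightarrow>
    (\<exists>\<zeta>. w = (\<Sum>(i, j)\<in>{..<n} \<times> {..<m}. \<zeta> (i, j) \<otimes> (e i \<otimes> f j))))"
  from add obtain A A' B B' where A: "finite A" "finite A'" "?P s A A'"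
    and B: "finite B" "finite B'" "?P t B B'"
    by blast
  have "\<exists>\<zeta>. s + t = (\<Sum>(i, j)\<in>{..<n} \<times> {..<m}. \<zeta> (i, j) \<otimes> (e i \<otimes> f j))"
    if cov: "covers {..<n} e (A \<union> B)" "covers {..<m} f (A' \<union> B')"
    for n m and e :: "nat \<Rightarrow> 'k" and f :: "nat \<Rightarrow> 'l"
  proof -
    obtain \<zeta> \<zeta>' where "s = (\<Sum>(i, j)\<in>{..<n} \<times> {..<m}. \<zeta> (i, j) \<otimes> (e i \<otimes> f j))"
      "t = (\<Sum>(i, j)\<in>{..<n} \<times> {..<m}. \<zeta>' (i, j) \<otimes> (e i \<otimes> f j))"
      using A(3)[rule_format, of n e m f] B(3)[rule_format, of n e m f] cov
      unfolding covers_Un by blast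
    then have "s + t = (\<Sum>(i, j)\<in>{..<n} \<times> {..<m}. (\<zeta> (i, j) + \<zeta>' (i, j)) \<otimes> (e i \<otimes> f j))"
      by (simp add: tensor_add_left sum.distrib case_prod_unfold)
    then show ?thesis by (rule exI[of _ "\<lambda>p. \<zeta> p + \<zeta>' p"])
  qed
  with A(1,2) B(1,2) show ?case by (intro exI[of _ "A \<union> B"] exI[of _ "A' \<union> B'"]) blast
qed

section \<open>The inner product on the algebraic tensor product\<close>

definition cinner_with :: "'k::complex_inner \<Rightarrow> 'l::complex_inner \<Rightarrow> ('k, 'l) tensor \<Rightarrow> complex"
  where "cinner_with x y = tensor_lift (\<lambda>x' y'. cinner x' x * cinner y' y)"

text \<open>\<open>cinner_with\<close> is the inner lift of \<open>hil_inner\<close>. It is linear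
  in the tensor and antilinear in \<open>x\<close> and \<open>y\<close>, so its conjugate is
  bilinear in them and the outer lift is legitimate as well.\<close>

lemma clinear_cinner_with: "clinear (cinner_with x y)"
  and cinner_with_tensor_of: "cinner_with x y (x' \<otimes> y') = cinner x' x * cinner y' y"
proof -
  have "cbilinear (\<lambda>x' y'. cinner x' x * cinner y' y)"
    by (rule cbilinearI)
      (simp_all add: cinner_add_left cinner_scaleC_left algebra_simps scaleC_complex_def)
  then show "clinear (cinner_with x y)"
    "cinner_with x y (x' \<otimes> y') = cinner x' x * cinner y' y"
    unfolding cinner_with_def by (rule clinear_tensor_lift, rule tensor_lift_tensor_of)
qed

lemma cinner_with_add_left: "cinner_with (x + x') y v = cinner_with x y v + cinner_with x' y v"
  by (induction v) (simp_all add: clinear_add[OF clinear_cinner_with] cinner_with_tensor_of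
      cinner_add_right algebra_simps)

lemma cinner_with_add_right: "cinner_with x (y + y') v = cinner_with x y v + cinner_with x y' v"
  by (induction v) (simp_all add: clinear_add[OF clinear_cinner_with] cinner_with_tensor_of
      cinner_add_right algebra_simps)

lemma cinner_with_scaleC:
  "cinner_with (a *\<^sub>C x) y v = cnj a * cinner_with x y v"
  "cinner_with x (a *\<^sub>C y) v = cnj a * cinner_with x y v"
  by (induction v) (simp_all add: clinear_add[OF clinear_cinner_with] cinner_with_tensor_of
      cinner_scaleC_right algebra_simps)

lemma clinear_hil_inner: "clinear (\<lambda>u. hil_inner u v)"
  and hil_inner_tensor_of_left: "hil_inner (x \<otimes> y) v = cnj (cinner_with x y v)"
proof -
  have "cbilinear (\<lambda>x y. cnj (cinner_with x y v))"
    by (rule cbilinearI) (simp_all add: cinner_with_add_left cinner_with_add_right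
        cinner_with_scaleC scaleC_complex_def)
  then show "clinear (\<lambda>u. hil_inner u v)" "hil_inner (x \<otimes> y) v = cnj (cinner_with x y v)"
    unfolding hil_inner_def cinner_with_def[symmetric]
    by (rule clinear_tensor_lift, rule tensor_lift_tensor_of)
qed

lemma hil_inner_tensor_of: "hil_inner (x \<otimes> y) (x' \<otimes> y') = cinner x x' * cinner y y'"
  using cinner_commute[of x x'] cinner_commute[of y y']
  by (simp add: hil_inner_tensor_of_left cinner_with_tensor_of)

lemma hil_inner_tensor_of_add:
  "hil_inner (x \<otimes> y) (u + v) = hil_inner (x \<otimes> y) u + hil_inner (x \<otimes> y) v"
  by (simp add: hil_inner_tensor_of_left clinear_add[OF clinear_cinner_with])

lemma hil_inner_commute: "hil_inner u v = cnj (hil_inner v u)"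
proof (induction u)
  case (tensor_of x y)
  show ?case
  proof (induction v)
    case (tensor_of x' y')
    then show ?case
      using cinner_commute[of x x'] cinner_commute[of y y'] by (simp add: hil_inner_tensor_of)
  next
    case (add s t)
    then show ?case by (simp add: hil_inner_tensor_of_add clinear_add[OF clinear_hil_inner])
  qed
next
  case (add s t)
  \<comment> \<open>Additivity in the second argument was available only for an elementary first
    argument; induction on \<open>v\<close> extends it.\<close>
  have "hil_inner v (s + t) = hil_inner v s + hil_inner v t"
    by (induction v) (simp_all add: hil_inner_tensor_of_add clinear_add[OF clinear_hil_inner])
  with add show ?case by (simp add: clinear_add[OF clinear_hil_inner])
qed

text \<open>Proved directly for \<open>hil_inner\<close>, before positivity is known: the
  \<open>e i \<otimes> f j\<close> are orthonormal for it. Since every tensor has such an expansion,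
  this formula is the source of positive definiteness.\<close>

lemma hil_inner_sum:
  fixes n m :: nat
  assumes "orthonormal_on {..<n} e" "orthonormal_on {..<m} f"
  shows "hil_inner (\<Sum>(i, j)\<in>{..<n} \<times> {..<m}. c (i, j) *\<^sub>C (e i \<otimes> f j))
      (\<Sum>(i, j)\<in>{..<n} \<times> {..<m}. c (i, j) *\<^sub>C (e i \<otimes> f j)) =
    complex_of_real (\<Sum>p\<in>{..<n} \<times> {..<m}. (cmod (c p))\<^sup>2)"
proof -
  let ?I = "{..<n} \<times> {..<m}"
  let ?g = "\<lambda>p. e (fst p) \<otimes> f (snd p)"
  let ?w = "\<Sum>p\<in>?I. c p *\<^sub>C ?g p"
  have on: "hil_inner (?g p) (?g q) = of_bool (p = q)" if "p \<in> ?I" "q \<in> ?I" for p q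
    using assms that by (auto simp: hil_inner_tensor_of orthonormal_on_def prod_eq_iff)
  have 1: "hil_inner ?w (?g q) = c q" if "q \<in> ?I" for q
  proof -
    have "hil_inner ?w (?g q) = (\<Sum>p\<in>?I. c p * hil_inner (?g p) (?g q))"
      by (simp add: clinear_sum[OF clinear_hil_inner] clinear_scaleC[OF clinear_hil_inner]
          scaleC_complex_def)
    also have "\<dots> = (\<Sum>p\<in>?I. if p = q then c p else 0)"
      using that by (intro sum.cong) (simp_all add: on)
    also have "\<dots> = c q"
      using that by (subst sum.delta) simp_all
    finally show ?thesis .
  qed
  have "hil_inner ?w ?w = (\<Sum>p\<in>?I. c p * hil_inner (?g p) ?w)"
    by (simp add: clinear_sum[OF clinear_hil_inner]
        clinear_scaleC[OF clinear_hil_inner] scaleC_complex_def)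
  also have "\<dots> = (\<Sum>p\<in>?I. c p * cnj (c p))"
    by (rule sum.cong) (simp_all only: hil_inner_commute[of _ ?w] 1)
  also have "\<dots> = complex_of_real (\<Sum>p\<in>?I. (cmod (c p))\<^sup>2)"
    by (simp add: complex_norm_square del: of_real_power)
  finally show ?thesis by (simp only: case_prod_unfold prod.collapse)
qed

lemma hil_norm_sum:
  fixes n m :: nat
  assumes "orthonormal_on {..<n} e" "orthonormal_on {..<m} f"
  shows "hil_norm (\<Sum>(i, j)\<in>{..<n} \<times> {..<m}. c (i, j) *\<^sub>C (e i \<otimes> f j)) =
    L2_set (\<lambda>p. cmod (c p)) ({..<n} \<times> {..<m})"
  unfolding hil_norm_def hil_inner_sum[OF assms] L2_set_def by simp

text \<open>One product family serves both tensors, so that addition becomes coordinatewise: the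
  sets to be covered are united before Gram-Schmidt is applied.\<close>

lemma two_tensors_expansion:
  fixes v w :: "('k::complex_inner, 'l::complex_inner) tensor"
  obtains n and e :: "nat \<Rightarrow> 'k" and m and f :: "nat \<Rightarrow> 'l" and b c
  where "orthonormal_on {..<n} e" "orthonormal_on {..<m} f"
    "v = (\<Sum>(i, j)\<in>{..<n} \<times> {..<m}. b (i, j) *\<^sub>C (e i \<otimes> f j))"
    "w = (\<Sum>(i, j)\<in>{..<n} \<times> {..<m}. c (i, j) *\<^sub>C (e i \<otimes> f j))"
proof -
  let ?P = "\<lambda>w A B. (\<forall>n (e :: nat \<Rightarrow> 'k) m (f :: nat \<Rightarrow> 'l).
    covers {..<n} e A \<longrightarrow> covers {..<m} f B \<longrightarrow>
    (\<exists>c. w = (\<Sum>(i, j)\<in>{..<n} \<times> {..<m}. c (i, j) *\<^sub>C (e i \<otimes> f j))))"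
  from tensor_product_support[of v] tensor_product_support[of w]
  obtain A A' B B' where A: "finite A" "finite A'" "?P v A A'"
    and B: "finite B" "finite B'" "?P w B B'"
    by blast
  have "finite (A \<union> B)" "finite (A' \<union> B')" using A B by simp_all
  from gram_schmidt[OF this(1)] gram_schmidt[OF this(2)]
  obtain n and e :: "nat \<Rightarrow> 'k" and m and f :: "nat \<Rightarrow> 'l"
    where on: "orthonormal_on {..<n} e" "orthonormal_on {..<m} f"
      and "covers {..<n} e (A \<union> B)" "covers {..<m} f (A' \<union> B')"
    by metis
  then obtain b c where v: "v = (\<Sum>(i, j)\<in>{..<n} \<times> {..<m}. b (i, j) *\<^sub>C (e i \<otimes> f j))"
      and w: "w = (\<Sum>(i, j)\<in>{..<n} \<times> {..<m}. c (i, j) *\<^sub>C (e i \<otimes> f j))"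
    using A(3)[rule_format, of n e m f] B(3)[rule_format, of n e m f]
    unfolding covers_Un by blast
  show ?thesis by (rule that[OF on v w])
qed

text \<open>The instance turns the tensor product with \<open>hil_norm\<close> into a pre-Hilbert
  type, so that the results below on \<open>minimal_L_norm norm\<close> also apply with this space
  as the second factor.\<close>

instantiation tensor :: (complex_inner, complex_inner) complex_inner
begin

definition norm_tensor :: "('a, 'b) tensor \<Rightarrow> real"
  where "norm_tensor = hil_norm"

definition cinner_tensor :: "('a, 'b) tensor \<Rightarrow> ('a, 'b) tensor \<Rightarrow> complex"
  where "cinner_tensor = hil_inner"

definition scaleR_tensor :: "real \<Rightarrow> ('a, 'b) tensor \<Rightarrow> ('a, 'b) tensor"
  where "scaleR_tensor r u = complex_of_real r *\<^sub>C u"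

definition sgn_tensor :: "('a, 'b) tensor \<Rightarrow> ('a, 'b) tensor"
  where "sgn_tensor u = inverse (norm u) *\<^sub>R u"

definition dist_tensor :: "('a, 'b) tensor \<Rightarrow> ('a, 'b) tensor \<Rightarrow> real"
  where "dist_tensor u v = norm (u - v)"

definition uniformity_tensor :: "(('a, 'b) tensor \<times> ('a, 'b) tensor) filter"
  where "uniformity_tensor = (INF e\<in>{0<..}. principal {(x, y). dist x y < e})"

definition open_tensor :: "('a, 'b) tensor set \<Rightarrow> bool"
  where "open_tensor S \<longleftrightarrow> (\<forall>x\<in>S. \<forall>\<^sub>F (x', y) in uniformity. x' = x \<longrightarrow> y \<in> S)"

instance
proof
  fix u v w :: "('a, 'b) tensor" and r s :: real and a b :: complex
  show "dist u v = norm (u - v)" by (rule dist_tensor_def)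
  show "sgn u = inverse (norm u) *\<^sub>R u" by (rule sgn_tensor_def)
  show "uniformity = (INF e\<in>{0<..}. principal {(x, y :: ('a, 'b) tensor). dist x y < e})"
    by (rule uniformity_tensor_def)
  show "open S \<longleftrightarrow> (\<forall>x\<in>S. \<forall>\<^sub>F (x', y) in uniformity. x' = x \<longrightarrow> y \<in> S)"
    for S :: "('a, 'b) tensor set"
    by (rule open_tensor_def)
  show "r *\<^sub>R (u + v) = r *\<^sub>R u + r *\<^sub>R v" "(r + s) *\<^sub>R u = r *\<^sub>R u + s *\<^sub>R u"
    "r *\<^sub>R s *\<^sub>R u = (r * s) *\<^sub>R u" "1 *\<^sub>R u = u" "r *\<^sub>R u = complex_of_real r *\<^sub>C u"
    by (simp_all add: scaleR_tensor_def scaleC_add_right scaleC_add_left scaleC_scaleC scaleC_one)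
  \<comment> \<open>In these common coordinates \<open>hil_norm\<close> is the Euclidean norm of the
    coefficients, which reduces definiteness, homogeneity and the triangle inequality to
    \<open>L2_set\<close>.\<close>
  from two_tensors_expansion[of u v] obtain n and e :: "nat \<Rightarrow> 'a" and m and f :: "nat \<Rightarrow> 'b" and b c
    where on: "orthonormal_on {..<n} e" "orthonormal_on {..<m} f"
    and u: "u = (\<Sum>(i, j)\<in>{..<n} \<times> {..<m}. b (i, j) *\<^sub>C (e i \<otimes> f j))"
    and v: "v = (\<Sum>(i, j)\<in>{..<n} \<times> {..<m}. c (i, j) *\<^sub>C (e i \<otimes> f j))"
    by blast
  let ?I = "{..<n} \<times> {..<m}"
  have nu: "norm u = L2_set (\<lambda>p. cmod (b p)) ?I"
    unfolding u norm_tensor_def by (rule hil_norm_sum[OF on])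
  show "norm u = 0 \<longleftrightarrow> u = 0"
  proof
    assume "norm u = 0"
    then have "b p = 0" if "p \<in> ?I" for p using that by (cases p) (simp add: nu L2_set_eq_0_iff)
    then show "u = 0" unfolding u by (intro sum.neutral) auto
  next
    assume "u = 0"
    then show "norm u = 0"
      by (simp add: norm_tensor_def hil_norm_def clinear_0[OF clinear_hil_inner])
  qed
  have "norm (u + v) = L2_set (\<lambda>p. cmod (b p + c p)) ?I"
    unfolding norm_tensor_def hil_norm_sum[OF on, symmetric]
    by (simp add: u v sum.distrib scaleC_add_left case_prod_unfold)
  also have "\<dots> \<le> L2_set (\<lambda>p. cmod (b p) + cmod (c p)) ?I"
    by (rule L2_set_mono) (simp_all add: norm_triangle_ineq)
  also have "\<dots> \<le> L2_set (\<lambda>p. cmod (b p)) ?I + L2_set (\<lambda>p. cmod (c p)) ?I"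
    by (rule L2_set_triangle_ineq)
  finally show "norm (u + v) \<le> norm u + norm v"
    unfolding u v norm_tensor_def hil_norm_sum[OF on] .
  show scale: "norm (a *\<^sub>C u) = cmod a * norm u" for a
  proof -
    have "norm (a *\<^sub>C u) = L2_set (\<lambda>p. cmod a * cmod (b p)) ?I"
      unfolding norm_tensor_def norm_mult[symmetric] hil_norm_sum[OF on, symmetric]
      by (simp add: u complex_vector.scale_sum_right scaleC_scaleC case_prod_unfold)
    then show ?thesis by (simp add: nu L2_set_right_distrib)
  qed
  show "norm (r *\<^sub>R u) = \<bar>r\<bar> * norm u"
    by (simp add: scaleR_tensor_def scale)
  show "cinner (u + v) w = cinner u w + cinner v w"
    by (simp add: cinner_tensor_def clinear_add[OF clinear_hil_inner])
  show "cinner (a *\<^sub>C u) v = a * cinner u v"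
    by (simp add: cinner_tensor_def clinear_scaleC[OF clinear_hil_inner] scaleC_complex_def)
  show "cinner u v = cnj (cinner v u)"
    unfolding cinner_tensor_def by (rule hil_inner_commute)
  show "cinner u u = complex_of_real ((norm u)\<^sup>2)"
    unfolding cinner_tensor_def norm_tensor_def u hil_norm_sum[OF on] hil_inner_sum[OF on]
    by (simp add: L2_set_def sum_nonneg)
qed

end

lemma cinner_tensor_of: "cinner (x \<otimes> y) (x' \<otimes> y') = cinner x x' * cinner y y'"
  by (simp add: cinner_tensor_def hil_inner_tensor_of)

lemma orthonormal_on_tensor_of:
  assumes "orthonormal_on I e" "orthonormal_on J f"
  shows "orthonormal_on (I \<times> J) (\<lambda>(i, j). e i \<otimes> f j)"
  using assms by (auto simp: orthonormal_on_def cinner_tensor_of)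

section \<open>The minimal $L$-norm on a pre-Hilbert space\<close>

definition slice :: "'k::complex_inner \<Rightarrow> ('h::complex_vector, 'k) tensor \<Rightarrow> 'h"
  where "slice y = tensor_lift (\<lambda>\<xi> x. cinner x y *\<^sub>C \<xi>)"

lemma clinear_slice: "clinear (slice y)"
  and slice_tensor_of: "slice y (\<xi> \<otimes> x) = cinner x y *\<^sub>C \<xi>"
proof -
  have "cbilinear (\<lambda>\<xi> x. cinner x y *\<^sub>C \<xi>)"
    by (rule cbilinearI) (simp_all add: cinner_add_left cinner_scaleC_left scaleC_add_left
        scaleC_add_right scaleC_scaleC mult.commute)
  then show "clinear (slice y)" "slice y (\<xi> \<otimes> x) = cinner x y *\<^sub>C \<xi>"
    unfolding slice_def by (rule clinear_tensor_lift, rule tensor_lift_tensor_of)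
qed

lemmas slice_add = clinear_add[OF clinear_slice]
  and slice_scaleC = clinear_scaleC[OF clinear_slice]

lemma slice_sum_tensors: "slice y (\<Sum>i\<in>I. \<xi> i \<otimes> x i) = (\<Sum>i\<in>I. cinner (x i) y *\<^sub>C \<xi> i)"
  by (simp add: clinear_sum[OF clinear_slice] slice_tensor_of)

lemma slice_add_arg: "slice (y + z) u = slice y u + slice z u"
  by (induction u) (simp_all add: slice_add slice_tensor_of cinner_add_right scaleC_add_left)

lemma slice_scaleC_arg: "slice (a *\<^sub>C y) u = cnj a *\<^sub>C slice y u"
  by (induction u)
    (simp_all add: slice_add slice_tensor_of cinner_scaleC_right scaleC_scaleC scaleC_add_right)

lemma slice_0_arg [simp]: "slice 0 u = 0"
  using slice_scaleC_arg[of 0 0 u] by simp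

lemma slice_sum_arg: "slice (\<Sum>i\<in>I. y i) u = (\<Sum>i\<in>I. slice (y i) u)"
  by (induction I rule: infinite_finite_induct) (simp_all add: slice_add_arg)

lemma slice_act: "clinear a \<Longrightarrow> slice y (act a u) = a (slice y u)"
  by (induction u) (simp_all add: slice_add slice_tensor_of clinear_add clinear_act act_tensor_of
      clinear_scaleC)

text \<open>In an orthonormal expansion, slicing at \<open>e i\<close> returns the coefficient
  \<open>\<xi> i\<close>.\<close>

lemma eq_0_if_slices_eq_0:
  assumes "\<And>y. slice y u = 0"
  shows "u = 0"
proof -
  obtain n \<xi> e where e: "orthonormal_on {..<n::nat} e" and u: "u = (\<Sum>i<n. \<xi> i \<otimes> e i)"
    by (rule tensor_orthonormal_expansion)
  have "\<xi> i = 0" if "i < n" for i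
  proof -
    have "slice (e i) u = (\<Sum>k<n. if k = i then \<xi> k else 0)"
      unfolding u slice_sum_tensors using e that
      by (intro sum.cong) (auto simp: orthonormal_on_def scaleC_one)
    with assms[of "e i"] that show ?thesis by simp
  qed
  then show ?thesis unfolding u by (intro sum.neutral) (simp add: clinear_0[OF clinear_tensor_left])
qed

section \<open>The minimal norm as the operator norm of the slices\<close>

definition product_functional :: "('a::complex_vector \<Rightarrow> complex) \<Rightarrow> ('b::complex_vector \<Rightarrow> complex) \<Rightarrow>
    ('a, 'b) tensor \<Rightarrow> complex"
  where "product_functional f g = tensor_lift (\<lambda>x y. f x * g y)"

lemma clinear_product_functional:
    "clinear f \<Longrightarrow> clinear g \<Longrightarrow> clinear (product_functional f g)"
  and product_functional_tensor_of:
    "clinear f \<Longrightarrow> clinear g \<Longrightarrow> product_functional f g (x \<otimes> y) = f x * g y"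
proof -
  assume "clinear f" "clinear g"
  then have "cbilinear (\<lambda>x y. f x * g y)"
    by (intro cbilinearI) (simp_all add: clinear_add clinear_scaleC scaleC_complex_def algebra_simps)
  then show "clinear (product_functional f g)" "product_functional f g (x \<otimes> y) = f x * g y"
    unfolding product_functional_def by (rule clinear_tensor_lift, rule tensor_lift_tensor_of)
qed

definition contractive_functional :: "('a::complex_normed_vector \<Rightarrow> complex) \<Rightarrow> bool"
  where "contractive_functional f \<longleftrightarrow> clinear f \<and> (\<forall>x. cmod (f x) \<le> norm x)"

text \<open>Cauchy-Schwarz. For \<open>y = 0\<close> division by zero yields the zero functional, so
  the fact can be applied to a slice that may vanish.\<close>

lemma contractive_functional_cinner:
  "contractive_functional (\<lambda>x. cinner x y / complex_of_real (norm y))"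
proof -
  have "clinear (\<lambda>x. cinner x y / complex_of_real (norm y))"
    by (rule clinearI) (simp_all add: cinner_add_left cinner_scaleC_left scaleC_complex_def add_divide_distrib)
  moreover have "cmod (cinner x y / complex_of_real (norm y)) \<le> norm x" for x
    using cauchy_schwarz[of x y] by (cases "y = 0") (simp_all add: norm_divide divide_simps)
  ultimately show ?thesis by (simp add: contractive_functional_def)
qed

lemma minimal_L_norm_eq:
  "minimal_L_norm norm u = Sup {cmod (product_functional f g u) | f g.
    contractive_functional f \<and> contractive_functional g}"
  unfolding minimal_L_norm_def injective_norm_def contractive_functional_def product_functional_def
  by (rule arg_cong[of _ _ Sup]) blast

text \<open>A real \<open>Sup\<close> says something only about a bounded set. The bound is
  \<open>norm x * norm y\<close> on elementary tensors and adds up along sums.\<close>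

lemma bdd_above_product_functionals:
  "bdd_above {cmod (product_functional f g u) | f g.
    contractive_functional f \<and> contractive_functional g}"
proof -
  have "\<exists>C. \<forall>f g. contractive_functional f \<longrightarrow> contractive_functional g \<longrightarrow>
      cmod (product_functional f g u) \<le> C"
  proof (induction u)
    case (tensor_of x y)
    have "cmod (product_functional f g (x \<otimes> y)) \<le> norm x * norm y"
      if "contractive_functional f" "contractive_functional g" for f g
      using that by (auto simp: contractive_functional_def product_functional_tensor_of norm_mult
          intro!: mult_mono)
    then show ?case by blast
  next
    case (add s t)
    then obtain C D where
      C: "\<And>f g. contractive_functional f \<Longrightarrow> contractive_functional g \<Longrightarrow> cmod (product_functional f g s) \<le> C"
      and D: "\<And>f g. contractive_functional f \<Longrightarrow> contractive_functional g \<Longrightarrow> cmod (product_functional f g t) \<le> D"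
      by metis
    have "cmod (product_functional f g (s + t)) \<le> C + D"
      if "contractive_functional f" "contractive_functional g" for f g
      using that C[OF that] D[OF that]
        norm_triangle_ineq[of "product_functional f g s" "product_functional f g t"]
      by (simp add: contractive_functional_def clinear_add[OF clinear_product_functional])
    then show ?case by blast
  qed
  then obtain C where "\<And>f g. contractive_functional f \<Longrightarrow> contractive_functional g \<Longrightarrow>
      cmod (product_functional f g u) \<le> C" by metis
  then show ?thesis by (intro bdd_aboveI[where M = C]) auto
qed

lemma product_functional_le:
  "contractive_functional f \<Longrightarrow> contractive_functional g \<Longrightarrow>
    cmod (product_functional f g u) \<le> minimal_L_norm norm u"
  unfolding minimal_L_norm_eq by (rule cSup_upper[OF _ bdd_above_product_functionals]) blast

lemma minimal_L_norm_nonneg: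
  fixes u :: "('h::complex_hilbert, 'e::complex_normed_vector) tensor"
  shows "0 \<le> minimal_L_norm norm u"
proof -
  have "contractive_functional (\<lambda>x. 0)"
    unfolding contractive_functional_def by (auto intro!: clinearI)
  from order_trans[OF norm_ge_zero product_functional_le[OF this this]] show ?thesis .
qed

text \<open>Test the supremum on the functionals induced by \<open>y\<close> and by the slice
  itself; their product takes the value \<open>norm (slice y u) / norm y\<close> at
  \<open>u\<close>.\<close>

lemma norm_slice_le: "norm (slice y u) \<le> minimal_L_norm norm u * norm y"
proof (cases "y = 0")
  case False
  define z where "z = slice y u"
  define f where "f = (\<lambda>\<xi>. cinner \<xi> z / complex_of_real (norm z))"
  define g where "g = (\<lambda>x. cinner x y / complex_of_real (norm y))"
  have fg: "contractive_functional f" "contractive_functional g"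
    unfolding f_def g_def by (rule contractive_functional_cinner)+
  then have lin: "clinear f" "clinear g" by (simp_all add: contractive_functional_def)
  have "product_functional f g v = f (slice y v) / complex_of_real (norm y)" for v
    by (induction v)
      (simp_all add: product_functional_tensor_of[OF lin] clinear_add[OF clinear_product_functional[OF lin]]
        slice_add slice_tensor_of clinear_add[OF lin(1)] clinear_scaleC[OF lin(1)]
        scaleC_complex_def add_divide_distrib, simp add: g_def)
  then have "product_functional f g u = f z / complex_of_real (norm y)"
    by (simp add: z_def)
  also have "\<dots> = complex_of_real (norm z / norm y)"
    by (simp add: f_def cinner_self power2_eq_square)
  finally have "norm z / norm y \<le> minimal_L_norm norm u"
    using product_functional_le[OF fg, of u] by (simp add: norm_divide)
  with False show ?thesis by (simp add: z_def divide_simps)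
qed simp

text \<open>Together with \<open>norm_slice_le\<close> this makes the minimal norm the least
  constant bounding the slices. The second functional matters only on the finite-dimensional span of
  \<open>e\<close>, where it is an inner product with a vector, so its pairing with \<open>u\<close>
  is a slice.\<close>

lemma minimal_L_norm_le:
  fixes u :: "('a::complex_hilbert, 'b::complex_inner) tensor"
  assumes C: "0 \<le> C" and le: "\<And>y. norm (slice y u) \<le> C * norm y"
  shows "minimal_L_norm norm u \<le> C"
proof -
  have "cmod (product_functional f g u) \<le> C"
    if f: "contractive_functional f" and g: "contractive_functional g" for f g
  proof -
    obtain n \<xi> e where e: "orthonormal_on {..<n::nat} e" and u: "u = (\<Sum>i<n. \<xi> i \<otimes> e i)"
      by (rule tensor_orthonormal_expansion)
    note lin = f[unfolded contractive_functional_def, THEN conjunct1]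
      g[unfolded contractive_functional_def, THEN conjunct1]
    \<comment> \<open>The Riesz vector of \<open>g\<close> on the span of \<open>e\<close>. Since
      \<open>g y\<close> is the square of \<open>norm y\<close>, contractivity of \<open>g\<close>
      forces \<open>norm y \<le> 1\<close>.\<close>
    define y where "y = (\<Sum>i<n. cnj (g (e i)) *\<^sub>C e i)"
    have y: "(norm y)\<^sup>2 = (\<Sum>i<n. (cmod (g (e i)))\<^sup>2)"
      using norm_orthonormal_sum[OF _ e, of "\<lambda>i. cnj (g (e i))"] by (simp add: y_def)
    have "g y = (\<Sum>i<n. complex_of_real ((cmod (g (e i)))\<^sup>2))"
      unfolding y_def clinear_sum[OF lin(2)] clinear_scaleC[OF lin(2)] scaleC_complex_def
      by (rule sum.cong) (simp_all add: complex_norm_square mult.commute del: of_real_power)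
    also have "\<dots> = complex_of_real ((norm y)\<^sup>2)"
      unfolding y by simp
    finally have "(norm y)\<^sup>2 \<le> norm y"
      using g by (metis contractive_functional_def norm_of_real abs_power2)
    then have "norm y \<le> 1"
      by (cases "y = 0") (simp_all add: power2_eq_square)
    have "slice y u = (\<Sum>i<n. g (e i) *\<^sub>C \<xi> i)"
      unfolding u slice_sum_tensors y_def
      by (rule sum.cong) (simp_all add: cinner_orthonormal_sum_right[OF _ e])
    then have "f (slice y u) = (\<Sum>i<n. g (e i) * f (\<xi> i))"
      by (simp add: clinear_sum[OF lin(1)] clinear_scaleC[OF lin(1)] scaleC_complex_def)
    also have "\<dots> = product_functional f g u"
      unfolding u clinear_sum[OF clinear_product_functional[OF lin]]
      by (simp add: product_functional_tensor_of[OF lin] mult.commute)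
    finally have "cmod (product_functional f g u) \<le> norm (slice y u)"
      using f by (metis contractive_functional_def)
    also have "\<dots> \<le> C * norm y" by (rule le)
    also have "\<dots> \<le> C" using mult_left_mono[OF \<open>norm y \<le> 1\<close> C] by simp
    finally show ?thesis .
  qed
  note bound = this
  have "contractive_functional (\<lambda>x :: 'a. 0)" "contractive_functional (\<lambda>x :: 'b. 0)"
    unfolding contractive_functional_def by (auto intro!: clinearI)
  then have "{cmod (product_functional f g u) | f g.
      contractive_functional f \<and> contractive_functional g} \<noteq> {}" by blast
  then show ?thesis
    unfolding minimal_L_norm_eq by (rule cSup_least) (auto simp: bound)
qed

text \<open>The upper bounds come from \<open>minimal_L_norm_le\<close> after the operation is
  pushed through \<open>slice\<close>, which is linear in the tensor and intertwines
  \<open>act a\<close> with \<open>a\<close>.\<close>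

lemma PL_norm_minimal:
  "PL_norm (minimal_L_norm norm :: ('h::complex_hilbert, 'k::complex_inner) tensor \<Rightarrow> real)"
proof -
  let ?N = "minimal_L_norm norm :: ('h, 'k) tensor \<Rightarrow> real"
  have scale_le: "?N (a *\<^sub>C u) \<le> cmod a * ?N u" for a u
  proof (rule minimal_L_norm_le)
    show "norm (slice y (a *\<^sub>C u)) \<le> cmod a * ?N u * norm y" for y
      using mult_left_mono[OF norm_slice_le[of y u], of "cmod a"]
      by (simp add: slice_scaleC norm_scaleC mult.assoc)
  qed (simp add: minimal_L_norm_nonneg)
  have "?N u = 0 \<longleftrightarrow> u = 0" for u
  proof
    assume "?N u = 0"
    then have "slice y u = 0" for y using norm_slice_le[of y u] by simp
    then show "u = 0" by (rule eq_0_if_slices_eq_0)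
  next
    assume "u = 0"
    then show "?N u = 0"
      using scale_le[of 0 0] minimal_L_norm_nonneg[of u] by simp
  qed
  moreover have "?N (u + v) \<le> ?N u + ?N v" for u v
  proof (rule minimal_L_norm_le)
    show "norm (slice y (u + v)) \<le> (?N u + ?N v) * norm y" for y
      using norm_slice_le[of y u] norm_slice_le[of y v] norm_triangle_ineq[of "slice y u" "slice y v"]
      by (simp add: slice_add distrib_right)
  qed (simp add: minimal_L_norm_nonneg)
  moreover have "?N (a *\<^sub>C u) = cmod a * ?N u" for a u
  proof (cases "a = 0")
    case True
    with scale_le[of a u] minimal_L_norm_nonneg[of "a *\<^sub>C u"] show ?thesis by simp
  next
    case False
    \<comment> \<open>The reverse inequality is the same estimate for \<open>1 / a\<close> at the
      tensor \<open>a *\<^sub>C u\<close>.\<close>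
    have "?N u \<le> cmod (1 / a) * ?N (a *\<^sub>C u)"
      using scale_le[of "1 / a" "a *\<^sub>C u"] False by (simp add: scaleC_scaleC scaleC_one)
    with False scale_le[of a u] show ?thesis by (simp add: norm_divide field_simps)
  qed
  moreover have "?N (act a u) \<le> onorm a * ?N u" if a: "bounded_clinear a" for a u
  proof (rule minimal_L_norm_le)
    have lin: "clinear a" "bounded_linear a" using a by (simp_all add: bounded_clinear_def)
    then have pos: "0 \<le> onorm a" by (simp add: onorm_pos_le)
    then show "0 \<le> onorm a * ?N u" by (simp add: minimal_L_norm_nonneg)
    show "norm (slice y (act a u)) \<le> onorm a * ?N u * norm y" for y
      using order_trans[OF onorm[OF lin(2), of "slice y u"]
          mult_left_mono[OF norm_slice_le[of y u] pos]]
      by (simp add: slice_act[OF lin(1)] mult.assoc)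
  qed
  ultimately show ?thesis unfolding PL_norm_def is_norm_def by blast
qed

text \<open>Cauchy-Schwarz bounds every slice, and the slice at \<open>x\<close> itself attains the
  bound.\<close>

lemma minimal_L_norm_tensor_of:
  fixes \<xi> :: "'h::complex_hilbert" and x :: "'k::complex_inner"
  shows "minimal_L_norm norm (\<xi> \<otimes> x) = norm \<xi> * norm x"
proof (rule antisym)
  show "minimal_L_norm norm (\<xi> \<otimes> x) \<le> norm \<xi> * norm x"
  proof (rule minimal_L_norm_le)
    show "norm (slice y (\<xi> \<otimes> x)) \<le> norm \<xi> * norm x * norm y" for y
      using mult_left_mono[OF cauchy_schwarz[of x y], of "norm \<xi>"]
      by (simp add: slice_tensor_of norm_scaleC algebra_simps)
  qed simp
  show "norm \<xi> * norm x \<le> minimal_L_norm norm (\<xi> \<otimes> x)"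
    using norm_slice_le[of x "\<xi> \<otimes> x"] minimal_L_norm_nonneg[of "\<xi> \<otimes> x"]
    by (cases "x = 0")
      (simp_all add: slice_tensor_of norm_scaleC cinner_self power2_eq_square norm_mult mult_ac)
qed

lemma slice_amplification:
  assumes W: "clinear W" "\<And>x y. cinner (W x) (W y) = cinner x y"
  shows "slice (W y) (amplification W u) = slice y u"
  by (induction u) (simp_all add: clinear_add[OF clinear_amplification[OF W(1)]]
      amplification_tensor_of[OF W(1)] slice_add slice_tensor_of W(2))

text \<open>The range of \<open>W\<close> may be a proper subspace, so the norm can be computed
  inside a completion. Slices at vectors \<open>W y\<close> are slices of \<open>u\<close>; the
  reverse bound has to treat slices at all vectors of the target.\<close>

lemma minimal_L_norm_amplification:
  fixes W :: "'k::complex_inner \<Rightarrow> 'd::complex_inner" and u :: "('h::complex_hilbert, 'k) tensor"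
  assumes W: "clinear W" and iso: "\<And>x. norm (W x) = norm x"
  shows "minimal_L_norm norm (amplification W u) = minimal_L_norm norm u"
proof (rule antisym)
  have inner: "cinner (W x) (W y) = cinner x y" for x y
    by (rule clinear_isometry_cinner[OF W iso])
  show "minimal_L_norm norm u \<le> minimal_L_norm norm (amplification W u)"
  proof (rule minimal_L_norm_le)
    show "norm (slice y u) \<le> minimal_L_norm norm (amplification W u) * norm y" for y
      using norm_slice_le[of "W y" "amplification W u"]
      by (simp add: slice_amplification[OF W inner] iso)
  qed (rule minimal_L_norm_nonneg)
  obtain n \<xi> e where e: "orthonormal_on {..<n::nat} e" and u: "u = (\<Sum>i<n. \<xi> i \<otimes> e i)"
    by (rule tensor_orthonormal_expansion)
  have We: "orthonormal_on {..<n} (\<lambda>i. W (e i))"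
    using e by (simp add: orthonormal_on_def inner)
  show "minimal_L_norm norm (amplification W u) \<le> minimal_L_norm norm u"
  proof (rule minimal_L_norm_le)
    fix y
    \<comment> \<open>\<open>W z\<close> is the orthogonal projection of \<open>y\<close> onto the
      span of the \<open>W (e i)\<close>. Only this projection affects the slice, and Bessel gives
      \<open>norm z \<le> norm y\<close>.\<close>
    define z where "z = (\<Sum>i<n. cinner y (W (e i)) *\<^sub>C e i)"
    have "(norm z)\<^sup>2 \<le> (norm y)\<^sup>2"
      using norm_orthonormal_sum[OF _ e, of "\<lambda>i. cinner y (W (e i))"] bessel[OF _ We, of y]
      by (simp add: z_def)
    then have zy: "norm z \<le> norm y" by simp
    have "slice y (amplification W u) = (\<Sum>i<n. cinner (W (e i)) y *\<^sub>C \<xi> i)"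
      by (simp add: u clinear_sum[OF clinear_amplification[OF W]] amplification_tensor_of[OF W]
          slice_sum_tensors)
    also have "\<dots> = slice z u"
      unfolding u slice_sum_tensors z_def
      by (rule sum.cong) (simp_all add: cinner_orthonormal_sum_right[OF _ e] flip: cinner_commute)
    finally have "norm (slice y (amplification W u)) \<le> minimal_L_norm norm u * norm z"
      using norm_slice_le by metis
    also have "\<dots> \<le> minimal_L_norm norm u * norm y"
      by (rule mult_left_mono[OF zy minimal_L_norm_nonneg])
    finally show "norm (slice y (amplification W u)) \<le> minimal_L_norm norm u * norm y" .
  qed (rule minimal_L_norm_nonneg)
qed

section \<open>The $l$-tensor product of pre-Hilbert spaces\<close>

lemma bounded_clinearI:
  assumes "clinear a" "\<And>x. norm (a x) \<le> C * norm x"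
  shows "bounded_clinear a"
proof -
  have "bounded_linear a"
    by (rule bounded_linear_intro[where K = C])
      (use assms in \<open>simp_all add: clinear_add clinear_scaleC scaleR_scaleC mult.commute\<close>)
  with assms(1) show ?thesis by (simp add: bounded_clinear_def)
qed

lemma orthonormal_on_subset: "orthonormal_on J e \<Longrightarrow> I \<subseteq> J \<Longrightarrow> orthonormal_on I e"
  unfolding orthonormal_on_def by blast

lemma norm_orthonormal: "orthonormal_on I e \<Longrightarrow> i \<in> I \<Longrightarrow> norm (e i) = 1"
proof -
  assume "orthonormal_on I e" "i \<in> I"
  then have "complex_of_real ((norm (e i))\<^sup>2) = complex_of_real 1"
    by (simp add: orthonormal_on_def cinner_self[symmetric] del: of_real_power)
  then have "(norm (e i))\<^sup>2 = 1" by (simp only: of_real_eq_iff)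
  then show ?thesis using norm_ge_zero[of "e i"] by (simp add: power2_eq_1_iff)
qed

text \<open>The sum acts as an antilinear partial isometry taking \<open>e i\<close> to
  \<open>\<xi> i\<close>; Bessel's inequality is its contractivity.\<close>

lemma minimal_L_norm_orthonormal_le:
  fixes \<xi> :: "nat \<Rightarrow> 'h::complex_hilbert" and e :: "nat \<Rightarrow> 'k::complex_inner"
  assumes \<xi>: "orthonormal_on {..<n} \<xi>" and e: "orthonormal_on {..<n} e"
  shows "minimal_L_norm norm (\<Sum>i<n. \<xi> i \<otimes> e i) \<le> 1"
proof (rule minimal_L_norm_le)
  fix y
  have "(norm (\<Sum>i<n. cinner (e i) y *\<^sub>C \<xi> i))\<^sup>2 \<le> (norm y)\<^sup>2"
    using norm_orthonormal_sum[OF _ \<xi>, of "\<lambda>i. cinner (e i) y"] bessel[OF _ e, of y]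
    by (simp add: cinner_commute[of _ y])
  then show "norm (slice y (\<Sum>i<n. \<xi> i \<otimes> e i)) \<le> 1 * norm y"
    by (simp add: slice_sum_tensors)
qed simp

text \<open>Terms with different \<open>f j\<close> are orthogonal, whatever the vectors
  \<open>y j\<close> are.\<close>

lemma tensor_norm_orthonormal:
  fixes y :: "nat \<Rightarrow> 'k::complex_inner" and f :: "nat \<Rightarrow> 'l::complex_inner"
  assumes f: "orthonormal_on {..<m} f"
  shows "(norm (\<Sum>j<m. y j \<otimes> f j))\<^sup>2 = (\<Sum>j<m. (norm (y j))\<^sup>2)"
proof -
  have "(norm (\<Sum>j<m. y j \<otimes> f j))\<^sup>2 = (\<Sum>j<m. (norm (y j \<otimes> f j))\<^sup>2)"
    using f by (intro pythagoras) (auto simp: cinner_tensor_of orthonormal_on_def)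
  also have "\<dots> = (\<Sum>j<m. (norm (y j))\<^sup>2)"
  proof (rule sum.cong)
    fix j assume j: "j \<in> {..<m}"
    have "complex_of_real ((norm (y j \<otimes> f j))\<^sup>2) = complex_of_real ((norm (y j))\<^sup>2)"
      using f j by (simp add: cinner_self[symmetric] cinner_tensor_of orthonormal_on_def del: of_real_power)
    then show "(norm (y j \<otimes> f j))\<^sup>2 = (norm (y j))\<^sup>2" by (simp only: of_real_eq_iff)
  qed simp
  finally show ?thesis .
qed

section \<open>The diamond operation for an isometric pairing on H\<close>

locale isometric_pairing =
  fixes d :: "'h::complex_hilbert \<Rightarrow> 'h \<Rightarrow> 'h"
  assumes bilinear: "cbilinear d"
    and inner: "cinner (d \<xi> \<eta>) (d \<xi>' \<eta>') = cinner \<xi> \<xi>' * cinner \<eta> \<eta>'"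
begin

lemma clinear_left: "clinear (\<lambda>\<xi>. d \<xi> \<eta>)"
  and clinear_right: "clinear (d \<xi>)"
  using bilinear by (simp_all add: cbilinear_def)

lemmas add_left = clinear_add[OF clinear_left]
  and scaleC_left = clinear_scaleC[OF clinear_left]
  and sum_left = clinear_sum[OF clinear_left]
  and add_right = clinear_add[OF clinear_right]
  and scaleC_right = clinear_scaleC[OF clinear_right]
  and sum_right = clinear_sum[OF clinear_right]

definition diamond_elementary ::
    "'h \<Rightarrow> 'e::complex_vector \<Rightarrow> ('h, 'f::complex_vector) tensor \<Rightarrow> ('h, ('e, 'f) tensor) tensor"
  where "diamond_elementary \<xi> x = tensor_lift (\<lambda>\<eta> y. d \<xi> \<eta> \<otimes> (x \<otimes> y))"

lemma clinear_diamond_elementary: "clinear (diamond_elementary \<xi> x)"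
  and diamond_elementary_tensor_of: "diamond_elementary \<xi> x (\<eta> \<otimes> y) = d \<xi> \<eta> \<otimes> (x \<otimes> y)"
proof -
  have "cbilinear (\<lambda>\<eta> y. d \<xi> \<eta> \<otimes> (x \<otimes> y))"
    by (rule cbilinearI) (simp_all add: add_right scaleC_right tensor_add_left tensor_add_right
        tensor_scaleC_left tensor_scaleC_right)
  then show "clinear (diamond_elementary \<xi> x)"
    "diamond_elementary \<xi> x (\<eta> \<otimes> y) = d \<xi> \<eta> \<otimes> (x \<otimes> y)"
    unfolding diamond_elementary_def by (rule clinear_tensor_lift, rule tensor_lift_tensor_of)
qed

lemmas diamond_elementary_simps = clinear_add[OF clinear_diamond_elementary]
  diamond_elementary_tensor_of add_left scaleC_left tensor_add_left tensor_add_right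
  tensor_scaleC_left tensor_scaleC_right scaleC_add_right

lemma diamond_elementary_bilinear:
  "diamond_elementary (\<xi> + \<xi>') x v = diamond_elementary \<xi> x v + diamond_elementary \<xi>' x v"
  "diamond_elementary (a *\<^sub>C \<xi>) x v = a *\<^sub>C diamond_elementary \<xi> x v"
  "diamond_elementary \<xi> (x + x') v = diamond_elementary \<xi> x v + diamond_elementary \<xi> x' v"
  "diamond_elementary \<xi> (a *\<^sub>C x) v = a *\<^sub>C diamond_elementary \<xi> x v"
  by (induction v) (simp_all add: diamond_elementary_simps)

lemma clinear_diamond: "clinear (\<lambda>u. diamond d u v)"
  and diamond_tensor_of_left: "diamond d (\<xi> \<otimes> x) v = diamond_elementary \<xi> x v"
proof -
  have "cbilinear (\<lambda>\<xi> x. diamond_elementary \<xi> x v)"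
    by (rule cbilinearI) (simp_all only: diamond_elementary_bilinear)
  then show "clinear (\<lambda>u. diamond d u v)" "diamond d (\<xi> \<otimes> x) v = diamond_elementary \<xi> x v"
    unfolding diamond_def diamond_elementary_def[symmetric]
    by (rule clinear_tensor_lift, rule tensor_lift_tensor_of)
qed

text \<open>Elementary tensors suffice by linearity in \<open>u\<close> and \<open>v\<close>. With
  \<open>slice_sum_arg\<close> the identity evaluates slices of \<open>diamond d u v\<close> at
  arbitrary tensors.\<close>

lemma slice_diamond: "slice (y \<otimes> z) (diamond d u v) = d (slice y u) (slice z v)"
proof (induction u)
  case (tensor_of \<xi> x)
  show ?case
    unfolding diamond_tensor_of_left
    by (induction v) (simp_all add: diamond_elementary_tensor_of slice_tensor_of cinner_tensor_of
        clinear_add[OF clinear_diamond_elementary] slice_add add_right scaleC_left scaleC_right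
        scaleC_scaleC mult.commute)
next
  case (add s t)
  then show ?case by (simp add: clinear_add[OF clinear_diamond] slice_add add_left)
qed

lemma norm_pairing: "norm (d \<xi> \<eta>) = norm \<xi> * norm \<eta>"
proof -
  have "complex_of_real ((norm (d \<xi> \<eta>))\<^sup>2) = complex_of_real ((norm \<xi> * norm \<eta>)\<^sup>2)"
    unfolding cinner_self[symmetric] inner by (simp add: cinner_self power_mult_distrib)
  then have "(norm (d \<xi> \<eta>))\<^sup>2 = (norm \<xi> * norm \<eta>)\<^sup>2" by (simp only: of_real_eq_iff)
  then show ?thesis by (simp add: power2_eq_iff_nonneg)
qed

text \<open>
  The boundedness of \<open>S \<otimes> T\<close> on the Hilbert tensor product: expanding the vectors \<open>S (y j)\<close> in an
  orthonormal basis turns the estimate for \<open>S\<close> into Bessel's inequality.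
\<close>

lemma norm_sum_slices_le:
  fixes u :: "('h, 'k::complex_inner) tensor" and v :: "('h, 'l::complex_inner) tensor"
  assumes f: "orthonormal_on {..<m::nat} f"
  shows "(norm (\<Sum>j<m. d (slice (y j) u) (slice (f j) v)))\<^sup>2 \<le>
    (minimal_L_norm norm u)\<^sup>2 * (minimal_L_norm norm v)\<^sup>2 * (\<Sum>j<m. (norm (y j))\<^sup>2)"
proof -
  let ?N = "minimal_L_norm norm"
  define t where "t j = slice (y j) u" for j
  obtain r and g :: "nat \<Rightarrow> 'h" where g: "orthonormal_on {..<r} g" and cov: "covers {..<r} g (t ` {..<m})"
    using gram_schmidt[of "t ` {..<m}"] by blast
  \<comment> \<open>Expanding each \<open>t j\<close> along \<open>g\<close> and collecting the
    terms with \<open>g i\<close> leaves this slice of \<open>v\<close>. The coefficients are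
    conjugated because \<open>slice\<close> is antilinear in its argument.\<close>
  define s where "s i = slice (\<Sum>j<m. cnj (cinner (t j) (g i)) *\<^sub>C f j) v" for i
  have "(\<Sum>j<m. d (t j) (slice (f j) v)) =
      (\<Sum>j<m. d (\<Sum>i<r. cinner (t j) (g i) *\<^sub>C g i) (slice (f j) v))"
    using cov by (intro sum.cong) (simp_all add: covers_def)
  also have "\<dots> = (\<Sum>i<r. \<Sum>j<m. d (cinner (t j) (g i) *\<^sub>C g i) (slice (f j) v))"
    unfolding sum_left by (rule sum.swap)
  also have "\<dots> = (\<Sum>i<r. d (g i) (s i))"
    by (simp add: s_def slice_sum_arg slice_scaleC_arg sum_right scaleC_left scaleC_right)
  finally have "(norm (\<Sum>j<m. d (t j) (slice (f j) v)))\<^sup>2 = (norm (\<Sum>i<r. d (g i) (s i)))\<^sup>2"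
    by simp
  \<comment> \<open>By \<open>inner\<close>, the inner product of two terms contains that of the
    corresponding vectors of \<open>g\<close>, so distinct terms are orthogonal.\<close>
  also have "\<dots> = (\<Sum>i<r. (norm (d (g i) (s i)))\<^sup>2)"
    using g by (intro pythagoras) (auto simp: inner orthonormal_on_def)
  also have "\<dots> \<le> (\<Sum>i<r. (?N v)\<^sup>2 * (\<Sum>j<m. (cmod (cinner (t j) (g i)))\<^sup>2))"
  proof (rule sum_mono)
    fix i assume i: "i \<in> {..<r}"
    let ?z = "\<Sum>j<m. cnj (cinner (t j) (g i)) *\<^sub>C f j"
    have "norm (d (g i) (s i)) \<le> ?N v * norm ?z"
      using norm_slice_le[of ?z v] norm_orthonormal[OF g i] by (simp add: norm_pairing s_def)
    then have "(norm (d (g i) (s i)))\<^sup>2 \<le> (?N v * norm ?z)\<^sup>2"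
      by (rule power_mono) simp
    also have "\<dots> = (?N v)\<^sup>2 * (\<Sum>j<m. (cmod (cinner (t j) (g i)))\<^sup>2)"
      using norm_orthonormal_sum[OF _ f, of "\<lambda>j. cnj (cinner (t j) (g i))"]
      by (simp add: power_mult_distrib)
    finally show "(norm (d (g i) (s i)))\<^sup>2 \<le> \<dots>" .
  qed
  also have "\<dots> = (?N v)\<^sup>2 * (\<Sum>j<m. \<Sum>i<r. (cmod (cinner (t j) (g i)))\<^sup>2)"
    unfolding sum_distrib_left[symmetric] by (subst sum.swap) (rule refl)
  also have "\<dots> \<le> (?N v)\<^sup>2 * (\<Sum>j<m. (?N u)\<^sup>2 * (norm (y j))\<^sup>2)"
  proof (intro mult_left_mono sum_mono)
    fix j
    have "(\<Sum>i<r. (cmod (cinner (t j) (g i)))\<^sup>2) \<le> (norm (t j))\<^sup>2"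
      by (rule bessel[OF _ g]) simp
    also have "\<dots> \<le> (?N u * norm (y j))\<^sup>2"
      unfolding t_def by (rule power_mono[OF norm_slice_le]) simp
    finally show "(\<Sum>i<r. (cmod (cinner (t j) (g i)))\<^sup>2) \<le> (?N u)\<^sup>2 * (norm (y j))\<^sup>2"
      by (simp add: power_mult_distrib)
  qed simp
  finally show ?thesis
    by (simp add: t_def sum_distrib_left mult_ac)
qed

lemma minimal_L_norm_act_le:
  fixes u :: "nat \<Rightarrow> ('h, 'k::complex_inner) tensor" and v :: "nat \<Rightarrow> ('h, 'l::complex_inner) tensor"
  assumes a: "bounded_clinear a" and K: "finite K"
    and supp: "\<And>k. k \<in> K \<Longrightarrow> support (P k) (u k)"
    and orth: "\<And>j k \<xi>. j \<in> K \<Longrightarrow> k \<in> K \<Longrightarrow> j \<noteq> k \<Longrightarrow> P j (P k \<xi>) = 0"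
  shows "minimal_L_norm norm (act a (\<Sum>k\<in>K. diamond d (u k) (v k))) \<le>
    onorm a * sqrt (\<Sum>k\<in>K. (minimal_L_norm norm (u k))\<^sup>2 * (minimal_L_norm norm (v k))\<^sup>2)"
    (is "_ \<le> onorm a * sqrt ?S")
proof (rule minimal_L_norm_le)
  have lin: "clinear a" "bounded_linear a" using a by (simp_all add: bounded_clinear_def)
  then have pos: "0 \<le> onorm a" by (simp add: onorm_pos_le)
  have S: "0 \<le> ?S" by (intro sum_nonneg) simp
  then show "0 \<le> onorm a * sqrt ?S" using pos by simp
  fix Y :: "('k, 'l) tensor"
  \<comment> \<open>With orthonormal second factors, \<open>(norm Y)\<^sup>2\<close> is exactly the
    sum of squares occurring in \<open>norm_sum_slices_le\<close>.\<close>
  obtain m y f where f: "orthonormal_on {..<m::nat} f" and Y: "Y = (\<Sum>j<m. y j \<otimes> f j)"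
    by (rule tensor_orthonormal_expansion)
  define z where "z k = (\<Sum>j<m. d (slice (y j) (u k)) (slice (f j) (v k)))" for k
  have slices: "slice Y (\<Sum>k\<in>K. diamond d (u k) (v k)) = (\<Sum>k\<in>K. z k)"
    by (simp add: clinear_sum[OF clinear_slice] Y slice_sum_arg slice_diamond z_def)
  have "cinner (z j) (z k) = 0" if "j \<in> K" "k \<in> K" "j \<noteq> k" for j k
  proof -
    have P: "clinear (P i)" "\<And>\<xi> \<eta>. cinner (P i \<xi>) \<eta> = cinner \<xi> (P i \<eta>)"
      "\<And>y. slice y (u i) = P i (slice y (u i))" if "i \<in> K" for i
      using supp[OF that] slice_act[of "P i" _ "u i"]
      by (auto simp: support_def projection_def bounded_clinear_def)
    \<comment> \<open>Slices of \<open>u j\<close> are fixed by \<open>P j\<close> and those of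
      \<open>u k\<close> by \<open>P k\<close>; self-adjointness moves \<open>P j\<close> across,
      where it annihilates the range of \<open>P k\<close>.\<close>
    have "cinner (slice y (u j)) (slice y' (u k)) = 0" for y y'
    proof -
      have "cinner (slice y (u j)) (slice y' (u k)) =
          cinner (P j (slice y (u j))) (P k (slice y' (u k)))"
        by (simp only: P(3)[OF that(1), symmetric] P(3)[OF that(2), symmetric])
      then show ?thesis
        using P(2)[OF that(1)] orth[OF that] by simp
    qed
    then show ?thesis by (simp add: z_def cinner_sum_left cinner_sum_right inner)
  qed
  then have "(norm (\<Sum>k\<in>K. z k))\<^sup>2 = (\<Sum>k\<in>K. (norm (z k))\<^sup>2)"
    by (intro pythagoras K)
  also have "\<dots> \<le> (\<Sum>k\<in>K. (minimal_L_norm norm (u k))\<^sup>2 * (minimal_L_norm norm (v k))\<^sup>2 * (norm Y)\<^sup>2)"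
    unfolding z_def Y tensor_norm_orthonormal[OF f] by (intro sum_mono norm_sum_slices_le f)
  also have "\<dots> = (sqrt ?S * norm Y)\<^sup>2"
    using S by (simp add: power_mult_distrib sum_distrib_right)
  finally have "norm (\<Sum>k\<in>K. z k) \<le> sqrt ?S * norm Y"
    using S by (simp add: power2_le_iff_abs_le)
  then have "onorm a * norm (\<Sum>k\<in>K. z k) \<le> onorm a * (sqrt ?S * norm Y)"
    using pos by (rule mult_left_mono)
  then show "norm (slice Y (act a (\<Sum>k\<in>K. diamond d (u k) (v k)))) \<le> onorm a * sqrt ?S * norm Y"
    using onorm[OF lin(2), of "\<Sum>k\<in>K. z k"] by (simp add: slice_act[OF lin(1)] slices mult.assoc)
qed

text \<open>
  One summand suffices: \<open>a\<close> maps the orthonormal vectors \<open>d (\<xi> i) (\<xi> j)\<close> to the coefficients of \<open>U\<close>.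
\<close>

lemma optimal_representation:
  fixes U :: "('h, ('k::complex_inner, 'l::complex_inner) tensor) tensor"
  assumes inf_dim: "\<not> (\<exists>B :: 'h set. finite B \<and> cspan B = UNIV)"
  obtains a u v where "bounded_clinear a" "onorm a \<le> minimal_L_norm norm U"
    "minimal_L_norm norm (u :: ('h, 'k) tensor) \<le> 1" "minimal_L_norm norm (v :: ('h, 'l) tensor) \<le> 1"
    "U = act a (diamond d u v)"
proof -
  obtain A B where AB: "finite A" "finite B"
    and rep: "\<forall>n (e :: nat \<Rightarrow> 'k) m (f :: nat \<Rightarrow> 'l).
      covers {..<n} e A \<longrightarrow> covers {..<m} f B \<longrightarrow>
      (\<exists>\<zeta>. U = (\<Sum>(i, j)\<in>{..<n} \<times> {..<m}. \<zeta> (i, j) \<otimes> (e i \<otimes> f j)))"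
    using triple_tensor_support[of U] by blast
  obtain n and e :: "nat \<Rightarrow> 'k" where e: "orthonormal_on {..<n} e" "covers {..<n} e A"
    by (rule gram_schmidt[OF AB(1)])
  obtain m and f :: "nat \<Rightarrow> 'l" where f: "orthonormal_on {..<m} f" "covers {..<m} f B"
    by (rule gram_schmidt[OF AB(2)])
  obtain \<zeta> where "U = (\<Sum>(i, j)\<in>{..<n} \<times> {..<m}. \<zeta> (i, j) \<otimes> (e i \<otimes> f j))"
    using rep[rule_format, OF e(2) f(2)] by blast
  define I where "I = {..<n} \<times> {..<m}"
  define ef where "ef = (\<lambda>(i, j). e i \<otimes> f j)"
  have U: "U = (\<Sum>p\<in>I. \<zeta> p \<otimes> ef p)"
    unfolding \<open>U = _\<close> I_def ef_def by (simp add: case_prod_unfold)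
  have ef: "orthonormal_on I ef"
    unfolding I_def ef_def by (rule orthonormal_on_tensor_of[OF e(1) f(1)])
  have I: "finite I" by (simp add: I_def)
  \<comment> \<open>One family, long enough for both \<open>u\<close> and \<open>v\<close>: by
    \<open>inner\<close>, the vectors \<open>d (\<xi> i) (\<xi> j)\<close> are orthonormal in the
    pair of indices.\<close>
  obtain \<xi> :: "nat \<Rightarrow> 'h" where \<xi>: "orthonormal_on {..<max n m} \<xi>"
    using orthonormal_sequence_exists[OF inf_dim] by blast
  have \<xi>n: "orthonormal_on {..<n} \<xi>" and \<xi>m: "orthonormal_on {..<m} \<xi>"
    by (rule orthonormal_on_subset[OF \<xi>], force)+
  define D where "D = (\<lambda>(i, j). d (\<xi> i) (\<xi> j))"
  have D: "orthonormal_on I D"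
    using \<xi>n \<xi>m by (auto simp: orthonormal_on_def I_def D_def inner)
  \<comment> \<open>A finite-rank operator on all of H: it sends \<open>D p\<close> to
    \<open>\<zeta> p\<close> and vanishes on the orthogonal complement of the span of
    \<open>D\<close>.\<close>
  define a where "a = (\<lambda>x. \<Sum>p\<in>I. cinner x (D p) *\<^sub>C \<zeta> p)"
  have "clinear a"
    unfolding a_def by (rule clinearI) (simp_all add: cinner_add_left cinner_scaleC_left
        scaleC_add_left sum.distrib scaleC_scaleC complex_vector.scale_sum_right)
  have bound: "norm (a x) \<le> minimal_L_norm norm U * norm x" for x
  proof -
    \<comment> \<open>Chosen so that \<open>a x\<close> is the slice of \<open>U\<close> at
      \<open>Y\<close>: the conjugates cancel the antilinearity of \<open>slice\<close>, and Bessel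
      for \<open>D\<close> gives \<open>norm Y \<le> norm x\<close>.\<close>
    define Y where "Y = (\<Sum>p\<in>I. cnj (cinner x (D p)) *\<^sub>C ef p)"
    have "(norm Y)\<^sup>2 \<le> (norm x)\<^sup>2"
      using norm_orthonormal_sum[OF I ef, of "\<lambda>p. cnj (cinner x (D p))"] bessel[OF I D, of x]
      by (simp add: Y_def)
    then have Y: "norm Y \<le> norm x" by simp
    have "a x = slice Y U"
      unfolding a_def U slice_sum_tensors Y_def
      by (rule sum.cong) (simp_all add: cinner_orthonormal_sum_right[OF I ef])
    then have "norm (a x) \<le> minimal_L_norm norm U * norm Y"
      using norm_slice_le[of Y U] by simp
    also have "\<dots> \<le> minimal_L_norm norm U * norm x"
      by (rule mult_left_mono[OF Y minimal_L_norm_nonneg])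
    finally show ?thesis .
  qed
  define u where "u = (\<Sum>i<n. \<xi> i \<otimes> e i)"
  define v where "v = (\<Sum>j<m. \<xi> j \<otimes> f j)"
  have "a (D p) = \<zeta> p" if "p \<in> I" for p
  proof -
    have "a (D p) = (\<Sum>q\<in>I. if q = p then \<zeta> q else 0)"
      unfolding a_def using D that by (intro sum.cong) (auto simp: orthonormal_on_def scaleC_one)
    then show ?thesis using I that by simp
  qed
  then have "U = (\<Sum>p\<in>I. a (D p) \<otimes> ef p)"
    unfolding U by simp
  also have "\<dots> = act a (\<Sum>p\<in>I. D p \<otimes> ef p)"
    by (simp add: clinear_sum[OF clinear_act[OF \<open>clinear a\<close>]] act_tensor_of[OF \<open>clinear a\<close>])
  also have "(\<Sum>p\<in>I. D p \<otimes> ef p) = (\<Sum>i<n. \<Sum>j<m. d (\<xi> i) (\<xi> j) \<otimes> (e i \<otimes> f j))"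
    unfolding I_def D_def ef_def sum.cartesian_product by (simp add: case_prod_unfold)
  also have "\<dots> = diamond d u v"
    by (simp add: u_def v_def clinear_sum[OF clinear_diamond] diamond_tensor_of_left
        clinear_sum[OF clinear_diamond_elementary] diamond_elementary_tensor_of)
  finally have "U = act a (diamond d u v)" .
  then show ?thesis
    using that[OF bounded_clinearI[OF \<open>clinear a\<close> bound] onorm_bound[OF minimal_L_norm_nonneg bound]]
      minimal_L_norm_orthonormal_le[OF \<xi>n e(1)] minimal_L_norm_orthonormal_le[OF \<xi>m f(1)]
    unfolding u_def v_def by blast
qed

theorem l_norm_minimal_eq:
  assumes inf_dim: "\<not> (\<exists>B :: 'h set. finite B \<and> cspan B = UNIV)"
  shows "l_norm d (minimal_L_norm norm) (minimal_L_norm norm) =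
    (minimal_L_norm norm :: ('h, ('k::complex_inner, 'l::complex_inner) tensor) tensor \<Rightarrow> real)"
proof
  fix U :: "('h, ('k, 'l) tensor) tensor"
  let ?N = "minimal_L_norm norm :: ('h, 'k) tensor \<Rightarrow> real"
  let ?M = "minimal_L_norm norm :: ('h, 'l) tensor \<Rightarrow> real"
  define R where "R = {onorm a * sqrt (\<Sum>k=1..n. (?N (u k))\<^sup>2 * (?M (v k))\<^sup>2) | a (n::nat) u v.
      bounded_clinear a \<and>
      (\<exists>P. (\<forall>k\<in>{1..n}. support (P k) (u k)) \<and>
           (\<forall>j\<in>{1..n}. \<forall>k\<in>{1..n}. j \<noteq> k \<longrightarrow> (\<forall>\<xi>. P j (P k \<xi>) = 0))) \<and>
      U = act a (\<Sum>k=1..n. diamond d (u k) (v k))}"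
  have l: "l_norm d ?N ?M U = Inf R" by (simp add: l_norm_def R_def)
  have lower: "minimal_L_norm norm U \<le> r" if "r \<in> R" for r
  proof -
    obtain a n u v P where r: "r = onorm a * sqrt (\<Sum>k=1..n::nat. (?N (u k))\<^sup>2 * (?M (v k))\<^sup>2)"
      and a: "bounded_clinear a" and P: "\<forall>k\<in>{1..n}. support (P k) (u k)"
        "\<forall>j\<in>{1..n}. \<forall>k\<in>{1..n}. j \<noteq> k \<longrightarrow> (\<forall>\<xi>. P j (P k \<xi>) = 0)"
      and U: "U = act a (\<Sum>k=1..n. diamond d (u k) (v k))"
      using \<open>r \<in> R\<close> unfolding R_def by blast
    show ?thesis
      unfolding r U by (rule minimal_L_norm_act_le[OF a, where P = P]) (use P in auto)
  qed
  obtain a u v where a: "bounded_clinear a" "onorm a \<le> minimal_L_norm norm U"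
    and uv: "?N u \<le> 1" "?M v \<le> 1" and U: "U = act a (diamond d u v)"
    by (rule optimal_representation[OF inf_dim])
  \<comment> \<open>The identity is a support of the single tensor \<open>u\<close>, and for one
    summand the orthogonality condition is vacuous.\<close>
  have id: "clinear (\<lambda>\<xi> :: 'h. \<xi>)" by (rule clinearI) (rule refl)+
  have "bounded_clinear (\<lambda>\<xi> :: 'h. \<xi>)"
    by (rule bounded_clinearI[OF id, of 1]) simp
  then have "projection (\<lambda>\<xi> :: 'h. \<xi>)"
    by (simp add: projection_def comp_def)
  moreover have "act (\<lambda>\<xi>. \<xi>) u = u"
    by (induction u) (simp_all only: act_tensor_of[OF id] clinear_add[OF clinear_act[OF id]])
  ultimately have "support (\<lambda>\<xi>. \<xi>) u" by (simp add: support_def)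
  then have mem: "onorm a * sqrt (\<Sum>k=1..1::nat. (?N u)\<^sup>2 * (?M v)\<^sup>2) \<in> R"
    unfolding R_def using a U
    by (intro CollectI exI[of _ a] exI[of _ 1] exI[of _ "\<lambda>_. u"] exI[of _ "\<lambda>_. v"] conjI
        exI[of _ "\<lambda>_ \<xi>. \<xi>"]) simp_all
  have "Inf R \<le> onorm a * (?N u * ?M v)"
    using cInf_lower[OF mem bdd_belowI[OF lower]] minimal_L_norm_nonneg[of u] minimal_L_norm_nonneg[of v]
    by (simp add: real_sqrt_mult)
  also have "\<dots> \<le> onorm a * 1"
    using uv a(1) minimal_L_norm_nonneg[of u] minimal_L_norm_nonneg[of v]
    by (intro mult_left_mono mult_le_one) (auto simp: bounded_clinear_def onorm_pos_le)
  also have "\<dots> \<le> minimal_L_norm norm U" using a(2) by simp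
  finally have "Inf R \<le> minimal_L_norm norm U" .
  moreover have "minimal_L_norm norm U \<le> Inf R"
    using mem lower by (intro cInf_greatest) auto
  ultimately show "l_norm d ?N ?M U = minimal_L_norm norm U" by (simp add: l)
qed

end

section \<open>Completions\<close>

lemma completion_sequence:
  assumes "completion_of p j"
  obtains s where "(\<lambda>m. j (s m)) \<longlonglongrightarrow> c"
proof -
  have "c \<in> closure (range j)" using assms by (simp add: completion_of_def)
  then obtain y where y: "\<forall>m. y m \<in> range j" "y \<longlonglongrightarrow> c"
    unfolding closure_sequential by blast
  from y(1) have "\<forall>m. \<exists>x. y m = j x" by blast
  then obtain s where "\<forall>m. y m = j (s m)" unfolding choice_iff by blast
  then have "y = (\<lambda>m. j (s m))" by (simp add: fun_eq_iff)
  with y(2) show ?thesis using that by simp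
qed

text \<open>Extension by continuity: \<open>i\<close> and \<open>j\<close> give the same norms, so a
  sequence is Cauchy under one exactly if it is under the other. The last conclusion covers every
  approximating sequence because \<open>completion_PL_norm\<close> quantifies over all of
  them.\<close>

lemma completion_extension:
  fixes j :: "'e::complex_vector \<Rightarrow> 'c::{complex_normed_vector, complete_space}"
    and i :: "'e \<Rightarrow> 'd::{complex_normed_vector, complete_space}"
  assumes j: "completion_of p j" and i: "completion_of p i"
  obtains \<phi> where "clinear \<phi>" "\<And>c. norm (\<phi> c) = norm c" "\<And>x. \<phi> (j x) = i x"
    "\<And>s c. (\<lambda>m. j (s m)) \<longlonglongrightarrow> c \<Longrightarrow> (\<lambda>m. i (s m)) \<longlonglongrightarrow> \<phi> c"
proof -
  have lin: "clinear j" "clinear i" using i j by (simp_all add: completion_of_def)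
  have norm: "norm (i x) = norm (j x)" for x using i j by (simp add: completion_of_def)
  have norm_diff: "norm (i x - i y) = norm (j x - j y)" for x y
    using norm[of "x - y"] by (simp add: clinear_diff lin)
  have "\<exists>s. (\<lambda>m. j (s m)) \<longlonglongrightarrow> c" for c
    by (rule completion_sequence[OF j], rule exI)
  note ex = this
  define \<sigma> where "\<sigma> c = (SOME s. (\<lambda>m. j (s m)) \<longlonglongrightarrow> c)" for c
  have \<sigma>: "(\<lambda>m. j (\<sigma> c m)) \<longlonglongrightarrow> c" for c
    unfolding \<sigma>_def by (rule someI_ex[OF ex])
  define \<phi> where "\<phi> c = lim (\<lambda>m. i (\<sigma> c m))" for c
  have lim: "(\<lambda>m. i (\<sigma> c m)) \<longlonglongrightarrow> \<phi> c" for c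
  proof -
    have "Cauchy (\<lambda>m. j (\<sigma> c m))" using \<sigma> by (rule LIMSEQ_imp_Cauchy)
    then have "Cauchy (\<lambda>m. i (\<sigma> c m))"
      by (simp add: Cauchy_def dist_norm norm_diff)
    then show ?thesis
      unfolding \<phi>_def convergent_LIMSEQ_iff[symmetric] by (rule Cauchy_convergent)
  qed
  \<comment> \<open>Independence of the chosen sequence: two sequences whose \<open>j\<close>-images
    have the same limit differ by a null sequence, and so do their \<open>i\<close>-images.\<close>
  have seq: "(\<lambda>m. i (s m)) \<longlonglongrightarrow> \<phi> c" if "(\<lambda>m. j (s m)) \<longlonglongrightarrow> c" for s c
  proof -
    have "(\<lambda>m. j (s m) - j (\<sigma> c m)) \<longlonglongrightarrow> 0"
      using tendsto_diff[OF that \<sigma>[of c]] by simp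
    then have "(\<lambda>m. i (s m) - i (\<sigma> c m)) \<longlonglongrightarrow> 0"
      by (subst (asm) tendsto_norm_zero_iff[symmetric], subst tendsto_norm_zero_iff[symmetric])
        (simp add: norm_diff)
    from tendsto_add[OF this lim[of c]] show ?thesis by simp
  qed
  have ext: "\<phi> (j x) = i x" for x
    using seq[of "\<lambda>_. x" "j x"] by (simp add: LIMSEQ_const_iff)
  have "clinear \<phi>"
  proof (rule clinearI)
    fix a :: complex and x y
    have "(\<lambda>m. j (\<sigma> x m + \<sigma> y m)) \<longlonglongrightarrow> x + y"
      unfolding clinear_add[OF lin(1)] by (intro tendsto_add \<sigma>)
    from seq[OF this] have "(\<lambda>m. i (\<sigma> x m) + i (\<sigma> y m)) \<longlonglongrightarrow> \<phi> (x + y)"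
      unfolding clinear_add[OF lin(2)] .
    with tendsto_add[OF lim lim] show "\<phi> (x + y) = \<phi> x + \<phi> y"
      using LIMSEQ_unique by blast
    have cont: "(\<lambda>m. a *\<^sub>C f m) \<longlonglongrightarrow> a *\<^sub>C l" if "f \<longlonglongrightarrow> l"
      for f :: "nat \<Rightarrow> 'x::complex_normed_vector" and l
    proof -
      have "bounded_linear (\<lambda>x :: 'x. a *\<^sub>C x)"
        by (rule bounded_linear_intro[where K = "cmod a"])
          (simp_all add: scaleC_add_right scaleR_scaleC scaleC_scaleC norm_scaleC mult.commute)
      then show ?thesis using that by (rule bounded_linear.tendsto)
    qed
    have "(\<lambda>m. j (a *\<^sub>C \<sigma> x m)) \<longlonglongrightarrow> a *\<^sub>C x"
      unfolding clinear_scaleC[OF lin(1)] by (intro cont \<sigma>)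
    from seq[OF this] have "(\<lambda>m. a *\<^sub>C i (\<sigma> x m)) \<longlonglongrightarrow> \<phi> (a *\<^sub>C x)"
      unfolding clinear_scaleC[OF lin(2)] .
    with cont[OF lim] show "\<phi> (a *\<^sub>C x) = a *\<^sub>C \<phi> x"
      using LIMSEQ_unique by blast
  qed
  moreover have "norm (\<phi> c) = norm c" for c
    using tendsto_norm[OF lim[of c]] tendsto_norm[OF \<sigma>[of c]] LIMSEQ_unique
    unfolding norm by blast
  ultimately show ?thesis using ext seq by (rule that)
qed

text \<open>The extensions in the two directions are mutually inverse, because each carries limits
  of images of a sequence in \<open>'e\<close> to limits of the other images of the same
  sequence.\<close>

lemma completion_isomorphism:
  fixes j :: "'e::complex_vector \<Rightarrow> 'c::{complex_normed_vector, complete_space}"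
    and i :: "'e \<Rightarrow> 'd::{complex_normed_vector, complete_space}"
  assumes j: "completion_of p j" and i: "completion_of p i"
  obtains \<phi> \<psi> where "clinear \<phi>" "clinear \<psi>" "\<And>c. norm (\<phi> c) = norm c" "\<And>x. \<phi> (j x) = i x"
    "\<And>s c. (\<lambda>m. j (s m)) \<longlonglongrightarrow> c \<Longrightarrow> (\<lambda>m. i (s m)) \<longlonglongrightarrow> \<phi> c"
    "\<And>c. \<psi> (\<phi> c) = c" "\<And>c. \<phi> (\<psi> c) = c"
proof -
  obtain \<phi> where \<phi>: "clinear \<phi>" "\<And>c. norm (\<phi> c) = norm c" "\<And>x. \<phi> (j x) = i x"
    "\<And>s c. (\<lambda>m. j (s m)) \<longlonglongrightarrow> c \<Longrightarrow> (\<lambda>m. i (s m)) \<longlonglongrightarrow> \<phi> c"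
    by (fact completion_extension[OF j i])
  obtain \<psi> where \<psi>: "clinear \<psi>" "\<And>c. norm (\<psi> c) = norm c" "\<And>x. \<psi> (i x) = j x"
    "\<And>s c. (\<lambda>m. i (s m)) \<longlonglongrightarrow> c \<Longrightarrow> (\<lambda>m. j (s m)) \<longlonglongrightarrow> \<psi> c"
    by (fact completion_extension[OF i j])
  have inv1: "\<psi> (\<phi> c) = c" for c
  proof -
    obtain s where s: "(\<lambda>m. j (s m)) \<longlonglongrightarrow> c" by (rule completion_sequence[OF j])
    show ?thesis by (rule LIMSEQ_unique[OF \<psi>(4)[OF \<phi>(4)[OF s]] s])
  qed
  have inv2: "\<phi> (\<psi> c) = c" for c
  proof -
    obtain s where s: "(\<lambda>m. i (s m)) \<longlonglongrightarrow> c" by (rule completion_sequence[OF i])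
    show ?thesis by (rule LIMSEQ_unique[OF \<phi>(4)[OF \<psi>(4)[OF s]] s])
  qed
  show ?thesis by (rule that[OF \<phi>(1) \<psi>(1) \<phi>(2,3,4) inv1 inv2])
qed

section \<open>The induced PL-norm on a completion\<close>

lemma tensor_finite_sum:
  fixes u :: "('a::complex_vector, 'b::complex_vector) tensor"
  obtains n :: nat and \<xi> x where "u = (\<Sum>i<n. \<xi> i \<otimes> x i)"
proof -
  have split: "(\<Sum>i<n + m. f i) = (\<Sum>i<n. f i) + (\<Sum>i<m. f (n + i))"
    for n m :: nat and f :: "nat \<Rightarrow> ('a, 'b) tensor"
    by (induction m) (simp_all add: add.assoc)
  have "\<exists>(n::nat) \<xi> x. u = (\<Sum>i<n. \<xi> i \<otimes> x i)"
  proof (induction u)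
    case (tensor_of \<xi> x)
    show ?case by (intro exI[of _ 1] exI[of _ "\<lambda>_. \<xi>"] exI[of _ "\<lambda>_. x"]) simp
  next
    case (add s t)
    then obtain n m :: nat and \<xi> x \<eta> y
      where "s = (\<Sum>i<n. \<xi> i \<otimes> x i)" "t = (\<Sum>i<m. \<eta> i \<otimes> y i)"
      by blast
    \<comment> \<open>The two representations are concatenated, the second shifted by
      \<open>n\<close>.\<close>
    then have "s + t = (\<Sum>i<n + m. (if i < n then \<xi> i else \<eta> (i - n)) \<otimes> (if i < n then x i else y (i - n)))"
      unfolding split by simp
    then show ?case
      by (intro exI[of _ "n + m"] exI[of _ "\<lambda>i. if i < n then \<xi> i else \<eta> (i - n)"]
          exI[of _ "\<lambda>i. if i < n then x i else y (i - n)"])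
  qed
  with that show ?thesis by blast
qed

lemma amplification_act:
  assumes \<phi>: "clinear \<phi>" and a: "clinear a"
  shows "amplification \<phi> (act a u) = act a (amplification \<phi> u)"
  by (induction u) (simp_all add: clinear_add[OF clinear_amplification[OF \<phi>]]
      clinear_add[OF clinear_act[OF a]] amplification_tensor_of[OF \<phi>] act_tensor_of[OF a])

lemma bij_amplification:
  assumes "clinear \<phi>" "clinear \<psi>" "\<And>c. \<psi> (\<phi> c) = c" "\<And>c. \<phi> (\<psi> c) = c"
  shows "bij (amplification \<phi>)"
proof (rule o_bij)
  show "amplification \<psi> \<circ> amplification \<phi> = id"
    by (simp add: fun_eq_iff amplification_comp[OF assms(1,2)] assms(3) amplification_id)
  show "amplification \<phi> \<circ> amplification \<psi> = id"
    by (simp add: fun_eq_iff amplification_comp[OF assms(2,1)] assms(4) amplification_id)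
qed

text \<open>Injectivity of the amplification gives definiteness. The lemma provides the PL-axioms on
  a completion, where the norm is known only as a limit.\<close>

lemma PL_norm_pullback:
  fixes M :: "('h::complex_hilbert, 'f::complex_vector) tensor \<Rightarrow> real"
    and \<phi> :: "'e::complex_vector \<Rightarrow> 'f"
  assumes M: "PL_norm M" and \<phi>: "clinear \<phi>"
    and inj: "inj (amplification \<phi> :: ('h, 'e) tensor \<Rightarrow> ('h, 'f) tensor)"
  shows "PL_norm (\<lambda>u. M (amplification \<phi> u))"
proof -
  note lin = clinear_amplification[OF \<phi>]
  have zero: "amplification \<phi> u = 0 \<longleftrightarrow> u = 0" for u :: "('h, 'e) tensor"
    using inj_eq[OF inj, of u 0] by (simp add: clinear_0[OF lin])
  show ?thesis
    using M unfolding PL_norm_def is_norm_def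
    by (auto simp: zero clinear_add[OF lin] clinear_scaleC[OF lin] amplification_act[OF \<phi>]
        bounded_clinear_def)
qed

lemma minimal_L_norm_diff_le:
  fixes u v :: "('h::complex_hilbert, 'k::complex_inner) tensor"
  shows "\<bar>minimal_L_norm norm u - minimal_L_norm norm v\<bar> \<le> minimal_L_norm norm (u - v)"
proof -
  let ?N = "minimal_L_norm norm :: ('h, 'k) tensor \<Rightarrow> real"
  have N: "?N (x + y) \<le> ?N x + ?N y" "?N (a *\<^sub>C x) = cmod a * ?N x" for x y a
    using PL_norm_minimal[where 'h = 'h and 'k = 'k] by (simp_all add: PL_norm_def is_norm_def)
  have "(- 1) *\<^sub>C (u - v) = v - u"
    by simp
  then have "?N (v - u) = ?N (u - v)" using N(2)[of "- 1" "u - v"] by simp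
  then show ?thesis using N(1)[of "u - v" v] N(1)[of "v - u" u] by simp
qed

lemma minimal_L_norm_sum_le:
  fixes \<xi> :: "nat \<Rightarrow> 'h::complex_hilbert" and x :: "nat \<Rightarrow> 'k::complex_inner"
  shows "minimal_L_norm norm (\<Sum>k<n. \<xi> k \<otimes> x k) \<le> (\<Sum>k<n. norm (\<xi> k) * norm (x k))"
proof (induction n)
  case 0
  have "minimal_L_norm norm (0 :: ('h, 'k) tensor) = 0"
    using PL_norm_minimal[where 'h = 'h and 'k = 'k] by (simp add: PL_norm_def is_norm_def)
  then show ?case by simp
next
  case (Suc n)
  have "minimal_L_norm norm ((\<Sum>k<n. \<xi> k \<otimes> x k) + \<xi> n \<otimes> x n) \<le>
      minimal_L_norm norm (\<Sum>k<n. \<xi> k \<otimes> x k) + minimal_L_norm norm (\<xi> n \<otimes> x n)"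
    using PL_norm_minimal[where 'h = 'h and 'k = 'k] by (simp add: PL_norm_def is_norm_def)
  with Suc show ?case by (simp add: minimal_L_norm_tensor_of)
qed

text \<open>For fixed first factors the norm is continuous in the second ones: the reverse triangle
  inequality and the norms of elementary tensors bound the difference.\<close>

lemma minimal_L_norm_tendsto:
  fixes \<xi> :: "nat \<Rightarrow> 'h::complex_hilbert" and x :: "nat \<Rightarrow> 'k::complex_inner"
  assumes "\<And>k. k < n \<Longrightarrow> (\<lambda>m. s k m) \<longlonglongrightarrow> x k"
  shows "(\<lambda>m. minimal_L_norm norm (\<Sum>k<n. \<xi> k \<otimes> s k m)) \<longlonglongrightarrow> minimal_L_norm norm (\<Sum>k<n. \<xi> k \<otimes> x k)"
proof -
  have "(\<lambda>m. \<Sum>k<n. norm (\<xi> k) * norm (s k m - x k)) \<longlonglongrightarrow> (\<Sum>k<n. norm (\<xi> k) * norm (x k - x k))"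
    using assms by (intro tendsto_intros) simp_all
  then have null: "(\<lambda>m. \<Sum>k<n. norm (\<xi> k) * norm (s k m - x k)) \<longlonglongrightarrow> 0" by simp
  have le: "norm (minimal_L_norm norm (\<Sum>k<n. \<xi> k \<otimes> s k m) - minimal_L_norm norm (\<Sum>k<n. \<xi> k \<otimes> x k))
      \<le> (\<Sum>k<n. norm (\<xi> k) * norm (s k m - x k))" for m
    using minimal_L_norm_diff_le[of "\<Sum>k<n. \<xi> k \<otimes> s k m" "\<Sum>k<n. \<xi> k \<otimes> x k"]
      minimal_L_norm_sum_le[of \<xi> "\<lambda>k. s k m - x k" n]
    by (simp add: tensor_diff_right sum_subtractf)
  show ?thesis
    by (rule LIM_zero_cancel[OF Lim_null_comparison[OF always_eventually[OF allI[OF le]] null]])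
qed

text \<open>The type \<open>'c\<close> carries no inner product, so the limit is computed through
  \<phi> in the Hilbert space \<open>'d\<close>. There the minimal norm is available, restricts to
  that of \<open>'e\<close> along \<open>i\<close>, and is continuous.\<close>

lemma completion_PL_norm_minimal:
  fixes j :: "'e::complex_inner \<Rightarrow> 'c::{complex_normed_vector, complete_space}"
    and i :: "'e \<Rightarrow> 'd::complex_hilbert" and u :: "('h::complex_hilbert, 'c) tensor"
  assumes j: "completion_of norm j" and i: "completion_of norm i" and \<phi>: "clinear \<phi>"
    and seq: "\<And>s c. (\<lambda>m. j (s m)) \<longlonglongrightarrow> c \<Longrightarrow> (\<lambda>m. i (s m)) \<longlonglongrightarrow> \<phi> c"
  shows "completion_PL_norm (minimal_L_norm norm) j u = minimal_L_norm norm (amplification \<phi> u)"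
proof -
  have lin: "clinear i" and iso: "norm (i x) = norm x" for x
    using i by (simp_all add: completion_of_def)
  have limit: "(\<lambda>m. minimal_L_norm norm (\<Sum>k<n. \<xi> k \<otimes> s k m)) \<longlonglongrightarrow> minimal_L_norm norm (amplification \<phi> u)"
    if u: "u = (\<Sum>k<n. \<xi> k \<otimes> x k)" and s: "\<forall>k<n. (\<lambda>m. j (s k m)) \<longlonglongrightarrow> x k"
    for n :: nat and \<xi> x and s :: "nat \<Rightarrow> nat \<Rightarrow> 'e"
  proof -
    have "(\<lambda>m. minimal_L_norm norm (\<Sum>k<n. \<xi> k \<otimes> i (s k m))) \<longlonglongrightarrow>
        minimal_L_norm norm (\<Sum>k<n. \<xi> k \<otimes> \<phi> (x k))"
      using s by (intro minimal_L_norm_tendsto seq) simp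
    moreover have "minimal_L_norm norm (\<Sum>k<n. \<xi> k \<otimes> i (s k m)) = minimal_L_norm norm (\<Sum>k<n. \<xi> k \<otimes> s k m)" for m
      using minimal_L_norm_amplification[OF lin iso, of "\<Sum>k<n. \<xi> k \<otimes> s k m"]
      by (simp add: clinear_sum[OF clinear_amplification[OF lin]] amplification_tensor_of[OF lin])
    moreover have "amplification \<phi> u = (\<Sum>k<n. \<xi> k \<otimes> \<phi> (x k))"
      by (simp add: u clinear_sum[OF clinear_amplification[OF \<phi>]] amplification_tensor_of[OF \<phi>])
    ultimately show ?thesis by simp
  qed
  \<comment> \<open>Uniqueness in the definite description needs at least one representation of
    \<open>u\<close> with approximating sequences; otherwise its condition would hold vacuously for
    every \<open>r\<close>.\<close>
  obtain n :: nat and \<xi> x where u: "u = (\<Sum>k<n. \<xi> k \<otimes> x k)" by (rule tensor_finite_sum)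
  have "\<forall>k. \<exists>s. (\<lambda>m. j (s m)) \<longlonglongrightarrow> x k"
    by (rule allI, rule completion_sequence[OF j], rule exI)
  then obtain s where s: "\<forall>k. (\<lambda>m. j (s k m)) \<longlonglongrightarrow> x k" unfolding choice_iff by blast
  show ?thesis
    unfolding completion_PL_norm_def
  proof (rule the_equality)
    show "\<forall>(n::nat) \<xi> x s. u = (\<Sum>i<n. \<xi> i \<otimes> x i) \<and> (\<forall>i<n. (\<lambda>m. j (s i m)) \<longlonglongrightarrow> x i) \<longrightarrow>
        (\<lambda>m. minimal_L_norm norm (\<Sum>i<n. \<xi> i \<otimes> s i m)) \<longlonglongrightarrow> minimal_L_norm norm (amplification \<phi> u)"
      using limit by blast
    fix r
    assume "\<forall>(n::nat) \<xi> x s. u = (\<Sum>i<n. \<xi> i \<otimes> x i) \<and> (\<forall>i<n. (\<lambda>m. j (s i m)) \<longlonglongrightarrow> x i) \<longrightarrow>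
        (\<lambda>m. minimal_L_norm norm (\<Sum>i<n. \<xi> i \<otimes> s i m)) \<longlonglongrightarrow> r"
    then have "(\<lambda>m. minimal_L_norm norm (\<Sum>i<n. \<xi> i \<otimes> s i m)) \<longlonglongrightarrow> r"
      using u s by blast
    with limit[OF u] s show "r = minimal_L_norm norm (amplification \<phi> u)"
      using LIMSEQ_unique by blast
  qed
qed

section \<open>L-isometric isomorphisms of completions\<close>

lemma underlying_norm_minimal:
  assumes "\<exists>\<xi> :: 'h::complex_hilbert. norm \<xi> = 1"
  shows "underlying_norm (minimal_L_norm norm :: ('h, 'k::complex_inner) tensor \<Rightarrow> real) = norm"
  using someI_ex[OF assms] by (simp add: fun_eq_iff underlying_norm_def minimal_L_norm_tensor_of)

lemma completion_L_isometric_isomorphism: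
  fixes j :: "'e::complex_inner \<Rightarrow> 'c::{complex_normed_vector, complete_space}"
    and i :: "'e \<Rightarrow> 'd::complex_hilbert"
    and N :: "('h::complex_hilbert, 'c) tensor \<Rightarrow> real"
  assumes unit: "\<exists>\<xi> :: 'h. norm \<xi> = 1"
    and j: "completion_of norm j" and i: "completion_of norm i"
    and N: "N = completion_PL_norm (minimal_L_norm norm) j"
  shows "\<exists>!\<phi>. L_isometric_isomorphism N (minimal_L_norm norm) \<phi> \<and> (\<forall>x. \<phi> (j x) = i x)"
proof -
  obtain \<phi> \<psi> where \<phi>: "clinear \<phi>" "clinear \<psi>" "\<And>c. norm (\<phi> c) = norm c" "\<And>x. \<phi> (j x) = i x"
    and seq: "\<And>s c. (\<lambda>m. j (s m)) \<longlonglongrightarrow> c \<Longrightarrow> (\<lambda>m. i (s m)) \<longlonglongrightarrow> \<phi> c"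
    and inv: "\<And>c. \<psi> (\<phi> c) = c" "\<And>c. \<phi> (\<psi> c) = c"
    by (fact completion_isomorphism[OF j i])
  have N_eq: "N u = minimal_L_norm norm (amplification \<phi> u)" for u
    unfolding N by (rule completion_PL_norm_minimal[OF j i \<phi>(1) seq])
  have bij: "bij (amplification \<phi> :: ('h, 'c) tensor \<Rightarrow> ('h, 'd) tensor)"
    by (rule bij_amplification[OF \<phi>(1,2) inv])
  have "PL_norm N"
    using PL_norm_pullback[OF PL_norm_minimal \<phi>(1) bij_is_inj[OF bij]] by (simp add: N_eq[abs_def])
  then have "L_isometric_isomorphism N (minimal_L_norm norm) \<phi> \<and> (\<forall>x. \<phi> (j x) = i x)"
    using PL_norm_minimal \<phi> bij by (simp add: L_isometric_isomorphism_def N_eq)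
  moreover have "\<phi>' = \<phi>"
    if \<phi>': "L_isometric_isomorphism N (minimal_L_norm norm) \<phi>' \<and> (\<forall>x. \<phi>' (j x) = i x)" for \<phi>'
  proof
    fix c
    have lin: "clinear \<phi>'" and iso: "\<And>u. minimal_L_norm norm (amplification \<phi>' u) = N u"
      using \<phi>' by (simp_all add: L_isometric_isomorphism_def)
    obtain \<xi> :: 'h where \<xi>: "norm \<xi> = 1" using unit by blast
    \<comment> \<open>Testing the L-isometry on a unit vector tensored with \<open>x\<close> shows
      that \<phi>' is isometric, hence continuous and determined by its values on the dense range of
      \<open>j\<close>.\<close>
    have norm: "norm (\<phi>' x) = norm x" for x
      using iso[of "\<xi> \<otimes> x"] \<xi>
      by (simp add: N_eq amplification_tensor_of lin \<phi> minimal_L_norm_tensor_of)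
    obtain s where s: "(\<lambda>m. j (s m)) \<longlonglongrightarrow> c" by (rule completion_sequence[OF j])
    then have "(\<lambda>m. norm (j (s m) - c)) \<longlonglongrightarrow> 0"
      by (simp add: tendsto_norm_zero_iff LIM_zero_iff)
    moreover have "norm (j (s m) - c) = norm (i (s m) - \<phi>' c)" for m
      using norm[of "j (s m) - c"] \<phi>' by (simp add: clinear_diff[OF lin])
    ultimately have "(\<lambda>m. i (s m)) \<longlonglongrightarrow> \<phi>' c"
      by (simp add: tendsto_norm_zero_iff LIM_zero_iff)
    then show "\<phi>' c = \<phi> c" using seq[OF s] by (rule LIMSEQ_unique)
  qed
  ultimately show ?thesis by blast
qed

text \<open>The embedding \<open>e\<close> is given only as an isometry for \<open>hil_norm\<close>;
  this is the class norm on tensors, so polarization makes \<open>e\<close> preserve inner products,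
  as \<iota> does by assumption.\<close>

lemma isometric_pairing_unitary:
  fixes e :: "('h::complex_hilbert, 'h) tensor \<Rightarrow> 'hh::complex_hilbert" and \<iota> :: "'hh \<Rightarrow> 'h"
  assumes e: "completion_of hil_norm e" and \<iota>: "unitary_iso \<iota>"
  shows "isometric_pairing (\<lambda>\<xi> \<eta>. \<iota> (e (\<xi> \<otimes> \<eta>)))"
proof
  have lin: "clinear e" "clinear \<iota>" and inner: "\<And>x y. cinner (\<iota> x) (\<iota> y) = cinner x y"
    using e \<iota> by (simp_all add: completion_of_def unitary_iso_def)
  have "norm (e u) = norm u" for u
    using e by (simp add: completion_of_def norm_tensor_def)
  from clinear_isometry_cinner[OF lin(1) this]
  show "cinner (\<iota> (e (\<xi> \<otimes> \<eta>))) (\<iota> (e (\<xi>' \<otimes> \<eta>'))) = cinner \<xi> \<xi>' * cinner \<eta> \<eta>'" for \<xi> \<eta> \<xi>' \<eta>'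
    by (simp add: inner cinner_tensor_of)
  show "cbilinear (\<lambda>\<xi> \<eta>. \<iota> (e (\<xi> \<otimes> \<eta>)))"
    by (rule cbilinearI) (simp_all add: tensor_add_left tensor_add_right tensor_scaleC_left
        tensor_scaleC_right clinear_add[OF lin(1)] clinear_add[OF lin(2)]
        clinear_scaleC[OF lin(1)] clinear_scaleC[OF lin(2)])
qed

section \<open>The algebraic and the completed l-tensor product\<close>

theorem theorem7p4:
  fixes e :: "('h::complex_hilbert, 'h) tensor \<Rightarrow> 'hh::complex_hilbert"
    and \<iota> :: "'hh \<Rightarrow> 'h"
    and d :: "'h \<Rightarrow> 'h \<Rightarrow> 'h"
    and minK :: "('h, 'k::complex_inner) tensor \<Rightarrow> real"
    and minL :: "('h, 'l::complex_inner) tensor \<Rightarrow> real"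
  assumes H_separable: "separable_space (euclidean :: 'h topology)"
    and H_infinite_dim: "\<not> (\<exists>B :: 'h set. finite B \<and> cspan B = UNIV)"
    and HH: "completion_of hil_norm e"
    and iota: "unitary_iso \<iota>"
    and d_def: "d = (\<lambda>\<xi> \<eta>. \<iota> (e (\<xi> \<otimes> \<eta>)))"
    and minK_def: "minK = minimal_L_norm norm"
    and minL_def: "minL = minimal_L_norm norm"
  shows "(\<exists>!\<phi> :: ('k, 'l) tensor \<Rightarrow> ('k, 'l) tensor.
      L_isometric_isomorphism (l_norm d minK minL) (minimal_L_norm hil_norm) \<phi> \<and>
      (\<forall>x y. \<phi> (x \<otimes> y) = x \<otimes> y)) \<and>
    (\<forall>(j :: ('k, 'l) tensor \<Rightarrow> 'c::{complex_normed_vector, complete_space})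
      (i :: ('k, 'l) tensor \<Rightarrow> 'd::complex_hilbert).
      completion_of (underlying_norm (l_norm d minK minL)) j \<and> completion_of hil_norm i \<longrightarrow>
      (\<exists>!\<phi> :: 'c \<Rightarrow> 'd.
        L_isometric_isomorphism
          (completion_PL_norm (l_norm d minK minL) j) (minimal_L_norm norm) \<phi> \<and>
        (\<forall>x y. \<phi> (j (x \<otimes> y)) = i (x \<otimes> y))))"
proof -
  interpret isometric_pairing d
    unfolding d_def by (rule isometric_pairing_unitary[OF HH iota])
  have hil: "hil_norm = (norm :: ('k, 'l) tensor \<Rightarrow> real)"
    by (simp add: norm_tensor_def)
  have l_norm: "l_norm d minK minL =
      (minimal_L_norm norm :: ('h, ('k, 'l) tensor) tensor \<Rightarrow> real)"
    unfolding minK_def minL_def by (rule l_norm_minimal_eq[OF H_infinite_dim])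
  \<comment> \<open>A unit vector must exist for the choice in \<open>underlying_norm\<close> to be
    meaningful; then \<open>j\<close> and \<open>i\<close> are completions of the same normed
    space.\<close>
  obtain \<xi> :: "nat \<Rightarrow> 'h" where "orthonormal_on {..<1} \<xi>"
    using orthonormal_sequence_exists[OF H_infinite_dim] by blast
  then have unit: "\<exists>\<xi> :: 'h. norm \<xi> = 1"
    using norm_orthonormal[of "{..<1}" \<xi> 0] by blast
  show ?thesis
    unfolding l_norm hil underlying_norm_minimal[OF unit]
  proof (intro conjI allI impI)
    have id: "clinear (\<lambda>x :: ('k, 'l) tensor. x)" by (rule clinearI) (rule refl)+
    have amp: "amplification (\<lambda>x :: ('k, 'l) tensor. x) = (\<lambda>u :: ('h, _) tensor. u)"
      by (rule ext) (rule amplification_id)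
    show "\<exists>!\<phi> :: ('k, 'l) tensor \<Rightarrow> ('k, 'l) tensor.
        L_isometric_isomorphism (minimal_L_norm norm :: ('h, _) tensor \<Rightarrow> real) (minimal_L_norm norm) \<phi> \<and>
        (\<forall>x y. \<phi> (x \<otimes> y) = x \<otimes> y)"
    \<comment> \<open>As the two norms coincide, the identity is L-isometric; uniqueness holds
      because elementary tensors generate.\<close>
    proof (rule ex1I[of _ "\<lambda>x. x"])
      show "L_isometric_isomorphism (minimal_L_norm norm :: ('h, _) tensor \<Rightarrow> real) (minimal_L_norm norm)
          (\<lambda>x :: ('k, 'l) tensor. x) \<and> (\<forall>x y. (x :: 'k) \<otimes> (y :: 'l) = x \<otimes> y)"
        unfolding L_isometric_isomorphism_def amp
        by (intro conjI PL_norm_minimal id bij_id[unfolded id_def] allI refl)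
      fix \<phi> :: "('k, 'l) tensor \<Rightarrow> ('k, 'l) tensor"
      assume "L_isometric_isomorphism (minimal_L_norm norm :: ('h, _) tensor \<Rightarrow> real) (minimal_L_norm norm) \<phi> \<and>
        (\<forall>x y. \<phi> (x \<otimes> y) = x \<otimes> y)"
      then have "clinear \<phi>" and tensors: "\<And>x y. \<phi> (x \<otimes> y) = x \<otimes> y"
        by (simp_all add: L_isometric_isomorphism_def)
      then show "\<phi> = (\<lambda>x. x)"
        by (intro ext) (rule clinear_eq_on_tensors[OF _ id])
    qed
    fix j :: "('k, 'l) tensor \<Rightarrow> 'c" and i :: "('k, 'l) tensor \<Rightarrow> 'd"
    assume "completion_of norm j \<and> completion_of norm i"
    then have j: "completion_of norm j" and i: "completion_of norm i" by simp_all
    then have lin: "clinear j" "clinear i" by (simp_all add: completion_of_def)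
    \<comment> \<open>The claim fixes \<phi> only on images of elementary tensors; by linearity this
      is the same as fixing it on the whole range of \<open>j\<close>.\<close>
    have agree: "(\<forall>x y. \<phi> (j (x \<otimes> y)) = i (x \<otimes> y)) \<longleftrightarrow> (\<forall>t. \<phi> (j t) = i t)"
      if "clinear \<phi>" for \<phi>
      using clinear_eq_on_tensors[OF clinear_compose[OF lin(1) that] lin(2)] by blast
    let ?L = "L_isometric_isomorphism
        (completion_PL_norm (minimal_L_norm norm) j :: ('h, 'c) tensor \<Rightarrow> real) (minimal_L_norm norm)"
    have "(\<lambda>\<phi>. ?L \<phi> \<and> (\<forall>x y. \<phi> (j (x \<otimes> y)) = i (x \<otimes> y))) = (\<lambda>\<phi>. ?L \<phi> \<and> (\<forall>t. \<phi> (j t) = i t))"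
      using agree by (auto simp: fun_eq_iff L_isometric_isomorphism_def)
    then show "\<exists>!\<phi>. ?L \<phi> \<and> (\<forall>x y. \<phi> (j (x \<otimes> y)) = i (x \<otimes> y))"
      using completion_L_isometric_isomorphism[OF unit j i refl] by simp
  qed
qed

end
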